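(* Let $A\in\mathbb{R}[\mathtt{x}]^{\alpha\times\alpha}$ be a linear pencil in the variables $\mathtt{x}=(\mathtt{x}_1,\dots,\mathtt{x}_n)$ and let $f\in\mathbb{R}[\mathtt{x}]_1$. Then $f\ge0$ on $S_A$ if and only if there exist $\ell_1,\dots,\ell_n\in\mathbb{R}[\mathtt{x}]_1$, quadratic sos-matrices $S_1,\dots,S_n\in\mathbb{R}[\mathtt{x}]_2^{\alpha\times\alpha}$, a real symmetric positive semidefinite matrix $S\in\mathbb{R}^{\alpha\times\alpha}$ and a real number $c\ge0$ such that \begin{align*} \ell_i^2+\operatorname{tr}(AS_i)&\in(\ell_1,\dots,\ell_{i-1})\quad\text{for all } i\in\{1,\dots,n\},\quad\text{and}\\ f-c-\operatorname{tr}(AS)&\in(\ell_1,\dots,\ell_n). \end{align*}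
   Context: Let $\mathtt{x}=(\mathtt{x}_1,\dots,\mathtt{x}_n)$ be commuting variables, $\mathbb{R}[\mathtt{x}]$ the polynomial ring and $\mathbb{R}[\mathtt{x}]_k$ the space of polynomials of degree at most $k$. A linear pencil of size $\alpha$ is a symmetric matrix $A\in\mathbb{R}[\mathtt{x}]^{\alpha\times\alpha}$ with entries in $\mathbb{R}[\mathtt{x}]_1$; its spectrahedron is $S_A:=\{x\in\mathbb{R}^n\mid A(x)\succeq0\}$ ($\succeq0$ means positive semidefinite). An sos-matrix of size $\alpha$ is a matrix of the form $P^*P$ with $P\in\mathbb{R}[\mathtt{x}]^{t\times\alpha}$ for some $t\in\mathbb{N}$ ($^*$ is transpose); it is quadratic if all its entries have degree at most $2$. $(p_1,\dots,p_r)$ denotes the ideal of $\mathbb{R}[\mathtt{x}]$ generated by $p_1,\dots,p_r$; for $r=0$ it is the zero ideal. *)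

theory Defs
  imports "HOL-Library.Poly_Mapping" "Jordan_Normal_Form.Matrix"
begin

text \<open>
  The number of variables \<open>n\<close> and the matrix size \<open>\<alpha>\<close> are arbitrary natural numbers, so polynomials
  live in one type with countably many variables, and the polynomial ring in \<open>n\<close> variables is the
  carrier set \<open>polys n\<close>. Variables are numbered from \<open>0\<close>, in line with the coordinates of
  \<open>real vec\<close>: the \<open>i\<close>-th variable of the mathematical text has index \<open>i - 1\<close>.
\<close>

type_synonym mpoly = "(nat \<Rightarrow>\<^sub>0 nat) \<Rightarrow>\<^sub>0 real"

definition polys :: "nat \<Rightarrow> mpoly set" where
  "polys n = {p. \<forall>m \<in> Poly_Mapping.keys p. Poly_Mapping.keys m \<subseteq> {..<n}}"

definition monom_degree :: "(nat \<Rightarrow>\<^sub>0 nat) \<Rightarrow> nat" where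
  "monom_degree m = (\<Sum>i \<in> Poly_Mapping.keys m. Poly_Mapping.lookup m i)"

definition polys_le :: "nat \<Rightarrow> nat \<Rightarrow> mpoly set" where
  "polys_le n k = {p \<in> polys n. \<forall>m \<in> Poly_Mapping.keys p. monom_degree m \<le> k}"

definition const_poly :: "real \<Rightarrow> mpoly" where
  "const_poly c = Poly_Mapping.single 0 c"

definition eval_poly :: "mpoly \<Rightarrow> real vec \<Rightarrow> real" where
  "eval_poly p x = (\<Sum>m \<in> Poly_Mapping.keys p.
     Poly_Mapping.lookup p m * (\<Prod>i \<in> Poly_Mapping.keys m. (x $ i) ^ Poly_Mapping.lookup m i))"

text \<open>The ideal of \<open>polys n\<close> generated by a list of polynomials; it is \<open>{0}\<close> for the empty list.\<close>

definition ideal_gen :: "nat \<Rightarrow> mpoly list \<Rightarrow> mpoly set" where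
  "ideal_gen n ps = {(\<Sum>k<length ps. q k * ps ! k) | q. \<forall>k<length ps. q k \<in> polys n}"

definition mat_trace :: "'a::comm_monoid_add mat \<Rightarrow> 'a" where
  "mat_trace M = (\<Sum>i<dim_row M. M $$ (i, i))"

definition sym_psd :: "nat \<Rightarrow> real mat \<Rightarrow> bool" where
  "sym_psd \<alpha> M \<longleftrightarrow> M \<in> carrier_mat \<alpha> \<alpha> \<and> transpose_mat M = M \<and>
     (\<forall>v \<in> carrier_vec \<alpha>. 0 \<le> v \<bullet> (M *\<^sub>v v))"

definition linear_pencil :: "nat \<Rightarrow> nat \<Rightarrow> mpoly mat \<Rightarrow> bool" where
  "linear_pencil n \<alpha> A \<longleftrightarrow> A \<in> carrier_mat \<alpha> \<alpha> \<and> transpose_mat A = A \<and>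
     elements_mat A \<subseteq> polys_le n 1"

definition spectrahedron :: "nat \<Rightarrow> nat \<Rightarrow> mpoly mat \<Rightarrow> real vec set" where
  "spectrahedron n \<alpha> A = {x \<in> carrier_vec n. sym_psd \<alpha> (map_mat (\<lambda>p. eval_poly p x) A)}"

definition sos_matrix :: "nat \<Rightarrow> nat \<Rightarrow> mpoly mat \<Rightarrow> bool" where
  "sos_matrix n \<alpha> S \<longleftrightarrow> (\<exists>t P. P \<in> carrier_mat t \<alpha> \<and> elements_mat P \<subseteq> polys n \<and>
     S = transpose_mat P * P)"

definition quadratic_sos_matrix :: "nat \<Rightarrow> nat \<Rightarrow> mpoly mat \<Rightarrow> bool" where
  "quadratic_sos_matrix n \<alpha> S \<longleftrightarrow> sos_matrix n \<alpha> S \<and> elements_mat S \<subseteq> polys_le n 2"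

end

theory Submission
  imports Defs "HOL-Analysis.Function_Topology"
begin

text \<open>
  Write \<open>u\<^sup>T A u\<close> for the affine polynomial obtained from a real vector \<open>u\<close>. The expressions
  \<open>c + tr (A S) - d f\<close> with \<open>c, d \<ge> 0\<close>, \<open>S\<close> positive semidefinite and \<open>c + d + tr S = 1\<close> form a compact
  convex set of affine polynomials. If it does not contain \<open>0\<close>, its point nearest to \<open>0\<close> is a linear
  functional that is positive on \<open>1\<close> and on all \<open>u\<^sup>T A u\<close> but negative on \<open>f\<close>; after scaling it is
  evaluation at a point of the spectrahedron where \<open>f < 0\<close>. So \<open>0\<close> belongs to the set. If \<open>d > 0\<close>, then
  \<open>f = c + tr (A S)\<close> after division by \<open>d\<close>. If \<open>d = 0\<close>, then \<open>c + tr (A S) = 0\<close> with \<open>S \<noteq> 0\<close>, and a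
  short computation produces an affine \<open>l \<noteq> 0\<close> and a quadratic sos-matrix \<open>Q\<close> with
  \<open>l\<^sup>2 + tr (A Q) = 0\<close>. A constant \<open>l\<close> generates the whole ring; otherwise one variable is eliminated
  modulo \<open>l\<close> and the argument is repeated with the remaining variables, so that \<open>n\<close> steps suffice.
  For the converse, the identities force \<open>l i\<close> to vanish on the spectrahedron one after the other.
\<close>

section \<open>Symmetric bilinear forms\<close>

text \<open>Vectors and matrices are functions of which only the values below \<open>n\<close>
  count. Any commutative ring is allowed, so real vectors and vectors of polynomials share one
  calculus.\<close>

definition bilin :: "nat \<Rightarrow> (nat \<Rightarrow> nat \<Rightarrow> 'a::comm_ring_1) \<Rightarrow> (nat \<Rightarrow> 'a) \<Rightarrow> (nat \<Rightarrow> 'a) \<Rightarrow> 'a"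
  where "bilin n M u v = (\<Sum>i<n. \<Sum>j<n. M i j * (u i * v j))"

lemma bilin_add_left: "bilin n M (\<lambda>i. u i + w i) v = bilin n M u v + bilin n M w v"
  and bilin_add_right: "bilin n M v (\<lambda>i. u i + w i) = bilin n M v u + bilin n M v w"
  and bilin_scale_left: "bilin n M (\<lambda>i. c * u i) v = c * bilin n M u v"
  and bilin_scale_right: "bilin n M v (\<lambda>i. c * u i) = c * bilin n M v u"
  by (simp_all add: bilin_def sum.distrib[symmetric] sum_distrib_left algebra_simps)

lemma bilin_commute:
  assumes "\<And>i j. i < n \<Longrightarrow> j < n \<Longrightarrow> M i j = M j i"
  shows "bilin n M u v = bilin n M v u"
  unfolding bilin_def by (subst sum.swap) (auto intro!: sum.cong simp: assms mult_ac)

lemma bilin_cong: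
  assumes "\<And>i j. i < n \<Longrightarrow> j < n \<Longrightarrow> M i j = M' i j"
    and "\<And>i. i < n \<Longrightarrow> u i = u' i" and "\<And>i. i < n \<Longrightarrow> v i = v' i"
  shows "bilin n M u v = bilin n M' u' v'"
  unfolding bilin_def by (auto intro!: sum.cong simp: assms)

lemma bilin_eq_sum_row: "bilin n M u v = (\<Sum>i<n. u i * (\<Sum>j<n. M i j * v j))"
  by (simp add: bilin_def sum_distrib_left mult_ac)

lemma sum_mult_unit:
  fixes g :: "nat \<Rightarrow> 'a::comm_ring_1"
  assumes "p < n"
  shows "(\<Sum>i<n. of_bool (i = p) * g i) = g p" and "(\<Sum>i<n. g i * of_bool (i = p)) = g p"
proof -
  have "{..<n} \<inter> {i. i = p} = {p}" using assms by auto
  then show "(\<Sum>i<n. of_bool (i = p) * g i) = g p" and "(\<Sum>i<n. g i * of_bool (i = p)) = g p"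
    by simp_all
qed

lemma bilin_unit:
  assumes "p < n" "q < n"
  shows "bilin n M (\<lambda>i. of_bool (i = p)) (\<lambda>i. of_bool (i = q)) = M p q"
  using assms by (simp only: bilin_eq_sum_row sum_mult_unit)

text \<open>Splitting off the last coordinate exhibits the form as a quadratic polynomial in
  \<open>u n\<close>, which drives the induction in \<open>psd_decomposition\<close>.\<close>

lemma bilin_Suc:
  assumes "\<And>i j. i < Suc n \<Longrightarrow> j < Suc n \<Longrightarrow> M i j = M j i"
  shows "bilin (Suc n) M u u = bilin n M u u + 2 * u n * (\<Sum>i<n. M i n * u i) + M n n * (u n)\<^sup>2"
proof -
  have "(\<Sum>j<n. M n j * (u n * u j)) = (\<Sum>i<n. M i n * (u i * u n))"
    by (intro sum.cong) (auto simp: assms)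
  then show ?thesis
    by (simp add: bilin_def sum.distrib sum_distrib_left power2_eq_square algebra_simps)
qed

text \<open>Induction by Schur complement: subtracting the rank-one matrix built from the last
  column clears that row and column and leaves a positive semidefinite matrix of size
  \<open>n\<close>.\<close>

lemma psd_decomposition:
  fixes S :: "nat \<Rightarrow> nat \<Rightarrow> real"
  assumes "\<And>i j. i < n \<Longrightarrow> j < n \<Longrightarrow> S i j = S j i" and "\<And>u. 0 \<le> bilin n S u u"
  shows "\<exists>w. \<forall>i<n. \<forall>j<n. S i j = (\<Sum>m<n. w m i * w m j)"
  using assms
proof (induction n arbitrary: S)
  case 0
  then show ?case by simp
next
  case (Suc n)
  define s where "s = S n n"
  have expand: "0 \<le> bilin n S u u + 2 * t * (\<Sum>i<n. S i n * u i) + s * t\<^sup>2" for u t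
  proof -
    have "bilin (Suc n) S (u(n := t)) (u(n := t)) =
        bilin n S u u + 2 * t * (\<Sum>i<n. S i n * u i) + s * t\<^sup>2"
      by (subst bilin_Suc) (auto simp: Suc.prems(1) s_def intro!: bilin_cong)
    then show ?thesis using Suc.prems(2) by metis
  qed
  have s0: "0 \<le> s"
    using expand[of "\<lambda>_. 0" 1] by (simp add: bilin_def)
  have cross: "S i n = 0" if "s = 0" "i < n" for i
  proof (rule ccontr)
    assume nz: "S i n \<noteq> 0"
    have e: "bilin n S (\<lambda>k. of_bool (k = i)) (\<lambda>k. of_bool (k = i)) = S i i"
      using that by (simp add: bilin_unit)
    have f: "(\<Sum>k<n. S k n * of_bool (k = i)) = S i n"
      using that by (simp only: sum_mult_unit)
    \<comment> \<open>With \<open>s = 0\<close> the form is affine in \<open>t\<close>; this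
      \<open>t\<close> gives it the value -1.\<close>
    show False
      using expand[of "\<lambda>k. of_bool (k = i)" "- (S i i + 1) / (2 * S i n)"] nz that
      by (simp only: e f) (simp add: field_simps)
  qed
  \<comment> \<open>If \<open>s = 0\<close>, the division yields 0, which agrees with
    \<open>cross\<close>: the last column then vanishes.\<close>
  define v where "v i = S i n / sqrt s" for i
  define S' where "S' i j = S i j - v i * v j" for i j
  have vn: "v i * v n = S i n" if "i < Suc n" for i
  proof (cases "s = 0")
    case True
    then show ?thesis using cross that s_def by (cases "i = n") (auto simp: v_def)
  next
    case False
    then show ?thesis using s0 by (simp add: v_def s_def[symmetric])
  qed
  have "0 \<le> bilin n S' u u" for u
  proof -
    let ?b = "\<Sum>i<n. S i n * u i"
    have vu: "(\<Sum>i<n. v i * u i) = ?b / sqrt s"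
      by (simp add: v_def sum_divide_distrib)
    have "bilin n S' u u = bilin n S u u - (\<Sum>i<n. v i * u i) * (\<Sum>j<n. v j * u j)"
      by (simp add: S'_def bilin_def sum_product sum_subtractf algebra_simps)
    also have "\<dots> = bilin n S u u - ?b\<^sup>2 / s"
      unfolding vu using s0 by (simp add: power2_eq_square)
    also have "\<dots> \<ge> 0"
    proof (cases "s = 0")
      case True
      then show ?thesis using expand[of u 0] by simp
    next
      case False
      \<comment> \<open>This \<open>t\<close> is the minimiser of the quadratic polynomial in
        \<open>expand\<close>.\<close>
      then show ?thesis using expand[of u "- ?b / s"] by (simp add: power2_eq_square field_simps)
    qed
    finally show ?thesis .
  qed
  moreover have "S' i j = S' j i" if "i < n" "j < n" for i j
    using that Suc.prems(1) by (simp add: S'_def mult_ac)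
  ultimately obtain w where w: "\<And>i j. i < n \<Longrightarrow> j < n \<Longrightarrow> S' i j = (\<Sum>m<n. w m i * w m j)"
    using Suc.IH[of S'] by blast
  \<comment> \<open>The vectors of the smaller matrix get last entry 0, and \<open>v\<close> becomes
    the vector with index \<open>n\<close>.\<close>
  define w' where "w' m i = (if m = n then v i else if i < n then w m i else 0)" for m i
  have "S i j = (\<Sum>m<Suc n. w' m i * w' m j)" if "i < Suc n" "j < Suc n" for i j
  proof (cases "i < n \<and> j < n")
    case True
    then show ?thesis using w[of i j] by (simp add: w'_def S'_def)
  next
    case False
    then have "(\<Sum>m<n. w' m i * w' m j) = 0" by (intro sum.neutral) (auto simp: w'_def)
    moreover have "v i * v j = S i j"
      using False that vn[of i] vn[of j] Suc.prems(1)[of i j]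
      by (metis less_SucE mult.commute)
    ultimately show ?thesis by (simp add: w'_def)
  qed
  then show ?case by blast
qed

section \<open>Separation in a compact convex set\<close>

text \<open>The point of a compact convex set nearest to the origin defines a strictly positive functional.\<close>

lemma min_norm_functional:
  fixes y z :: "nat \<Rightarrow> real"
  assumes min: "\<And>t. 0 \<le> t \<Longrightarrow> t \<le> 1 \<Longrightarrow>
      (\<Sum>k\<le>N. (y k)\<^sup>2) \<le> (\<Sum>k\<le>N. ((1 - t) * y k + t * z k)\<^sup>2)"
  shows "(\<Sum>k\<le>N. (y k)\<^sup>2) \<le> (\<Sum>k\<le>N. y k * z k)"
proof (rule ccontr)
  define a where "a = (\<Sum>k\<le>N. (y k)\<^sup>2)"
  define b where "b = (\<Sum>k\<le>N. y k * z k)"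
  define e where "e = (\<Sum>k\<le>N. (z k - y k)\<^sup>2)"
  assume "\<not> ?thesis"
  then have ba: "b < a" by (simp add: a_def b_def)
  have e0: "0 \<le> e" by (simp add: e_def sum_nonneg)
  have expand: "(\<Sum>k\<le>N. ((1 - t) * y k + t * z k)\<^sup>2) = a + 2 * t * (b - a) + t\<^sup>2 * e" for t
  proof -
    have "(p + t * (q - p))\<^sup>2 = p\<^sup>2 + 2 * t * (p * q - p\<^sup>2) + t\<^sup>2 * (q - p)\<^sup>2" for p q :: real
      unfolding power2_eq_square by (simp add: field_simps)
    moreover have "(1 - t) * p + t * q = p + t * (q - p)" for p q :: real
      by (simp add: algebra_simps)
    ultimately have "(\<Sum>k\<le>N. ((1 - t) * y k + t * z k)\<^sup>2) =
        (\<Sum>k\<le>N. (y k)\<^sup>2 + 2 * t * (y k * z k - (y k)\<^sup>2) + t\<^sup>2 * (z k - y k)\<^sup>2)"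
      by simp
    also have "\<dots> = a + 2 * t * (b - a) + t\<^sup>2 * e"
      unfolding a_def b_def e_def by (simp only: sum.distrib sum_subtractf sum_distrib_left[symmetric])
    finally show ?thesis .
  qed
  \<comment> \<open>If \<open>b < a\<close>, a short step towards \<open>z\<close> decreases the
    norm. This \<open>t\<close> makes the quadratic term \<open>t * e\<close> smaller than
    \<open>a - b\<close>; the summand 1 keeps the denominator positive.\<close>
  define t where "t = min 1 ((a - b) / (e + 1))"
  have t: "0 < t" "t \<le> 1" "t * (e + 1) \<le> a - b"
  proof -
    show "0 < t" "t \<le> 1" using ba e0 by (simp_all add: t_def)
    have "t \<le> (a - b) / (e + 1)" by (simp add: t_def)
    then show "t * (e + 1) \<le> a - b" using e0 by (simp add: pos_le_divide_eq)
  qed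
  have "0 \<le> 2 * t * (b - a) + t\<^sup>2 * e"
    using min[of t] t expand[of t] by (simp add: a_def)
  then have "0 \<le> t * (2 * (b - a) + t * e)"
    by (simp add: power2_eq_square algebra_simps)
  then have "0 \<le> 2 * (b - a) + t * e" using t(1) by (simp add: zero_le_mult_iff)
  with t ba show False by (simp add: algebra_simps)
qed

text \<open>The index \<open>k\<close> runs over the coefficients of an affine polynomial, with 0
  for the constant one. The norm of the coefficient vector of c + tr (A S) - d f is minimised over
  normalised triples. Minimum 0 gives the combination; otherwise the minimising vector itself is the
  functional. A zero diagonal outside \<open>I\<close> confines positive semidefinite
  \<open>S\<close> to the block indexed by \<open>I\<close>.\<close>

lemma psd_alternative:
  fixes a :: "nat \<Rightarrow> nat \<Rightarrow> nat \<Rightarrow> real" and f :: "nat \<Rightarrow> real"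
  assumes I: "I \<subseteq> {..<n}"
  obtains
    (combination) c d S where "0 \<le> c" "0 \<le> d"
      "\<And>i j. S i j = S j i" "\<And>u. 0 \<le> bilin n S u u" "\<And>i. i \<notin> I \<Longrightarrow> S i i = 0"
      "c + d + (\<Sum>i<n. S i i) = 1"
      "\<And>k. k \<le> N \<Longrightarrow> d * f k = c * of_bool (k = 0) + (\<Sum>i<n. \<Sum>j<n. a i j k * S i j)"
  | (functional) y where "0 < y 0" "(\<Sum>k\<le>N. y k * f k) < 0"
      "\<And>u. (\<And>i. i \<notin> I \<Longrightarrow> u i = 0) \<Longrightarrow> 0 \<le> bilin n (\<lambda>i j. \<Sum>k\<le>N. y k * a i j k) u u"
proof -
  \<comment> \<open>Matrices are functions on all of nat x nat, so compactness comes from a product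
    of intervals; trace at most 1 is what keeps the relevant entries in [-1, 1].\<close>
  define box :: "(real \<times> real \<times> (nat \<Rightarrow> nat \<Rightarrow> real)) set"
    where "box = {0..1} \<times> {0..1} \<times> (UNIV \<rightarrow>\<^sub>E (UNIV \<rightarrow>\<^sub>E {-1..1}))"
  define K where "K = {(c, d, S). (\<forall>i j. S i j = S j i) \<and> (\<forall>u. 0 \<le> bilin n S u u) \<and>
    (\<forall>i. i \<notin> I \<longrightarrow> S i i = 0) \<and> c + d + (\<Sum>i<n. S i i) = 1} \<inter> box"
  have compact_PiE: "compact (UNIV \<rightarrow>\<^sub>E B)" if "compact B"
    for B :: "'b::topological_space set"
    using that by (metis compactin_PiE compactin_euclidean_iff euclidean_product_topology)
  have "compact box"
    unfolding box_def by (intro compact_Times compact_PiE compact_Icc)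
  moreover have cont: "continuous_on UNIV (\<lambda>z :: real \<times> real \<times> (nat \<Rightarrow> nat \<Rightarrow> real). fst z)"
    "continuous_on UNIV (\<lambda>z :: real \<times> real \<times> (nat \<Rightarrow> nat \<Rightarrow> real). fst (snd z))"
    "\<And>i j. continuous_on UNIV (\<lambda>z :: real \<times> real \<times> (nat \<Rightarrow> nat \<Rightarrow> real). snd (snd z) i j)"
    by (rule continuous_on_fst continuous_on_snd continuous_on_id
        continuous_on_product_then_coordinatewise)+
  have "closed {(c, d, S). (\<forall>i j. S i j = S j i) \<and> (\<forall>u. 0 \<le> bilin n S u u) \<and>
      (\<forall>i. i \<notin> I \<longrightarrow> S i i = 0) \<and> c + d + (\<Sum>i<n. S i i) = (1::real)}"
    unfolding split_def bilin_def
    by (intro closed_Collect_conj closed_Collect_all closed_Collect_imp closed_Collect_eq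
        closed_Collect_le open_Collect_const cont continuous_on_const continuous_on_add
        continuous_on_mult continuous_on_sum)
  ultimately have "compact K"
    unfolding K_def by (simp add: closed_Int_compact)
  define \<phi> where "\<phi> k z = (case z of (c, d, S) \<Rightarrow>
    c * of_bool (k = 0) + (\<Sum>i<n. \<Sum>j<n. a i j k * S i j) - d * f k)" for k and z :: "real \<times> real \<times> (nat \<Rightarrow> nat \<Rightarrow> real)"
  have in_K: "(c, d, S) \<in> K \<longleftrightarrow> (\<forall>i j. S i j = S j i) \<and> (\<forall>u. 0 \<le> bilin n S u u) \<and>
    (\<forall>i. i \<notin> I \<longrightarrow> S i i = 0) \<and> c + d + (\<Sum>i<n. S i i) = 1 \<and>
    0 \<le> c \<and> c \<le> 1 \<and> 0 \<le> d \<and> d \<le> 1 \<and> (\<forall>i j. -1 \<le> S i j \<and> S i j \<le> 1)" for c d S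
    by (auto simp: K_def box_def PiE_iff)
  have "continuous_on K (\<lambda>z. \<Sum>k\<le>N. (\<phi> k z)\<^sup>2)"
    unfolding \<phi>_def split_def
    by (rule continuous_on_subset[OF _ subset_UNIV]) (intro cont continuous_on_const
        continuous_on_add continuous_on_diff continuous_on_mult continuous_on_sum continuous_on_power)
  moreover have K1: "(1, 0, \<lambda>_ _. 0) \<in> K" and K2: "(0, 1, \<lambda>_ _. 0) \<in> K"
    by (auto simp: in_K bilin_def)
  ultimately obtain z0 where z0: "z0 \<in> K"
    and min: "\<And>z. z \<in> K \<Longrightarrow> (\<Sum>k\<le>N. (\<phi> k z0)\<^sup>2) \<le> (\<Sum>k\<le>N. (\<phi> k z)\<^sup>2)"
    using continuous_attains_inf[OF \<open>compact K\<close>, of "\<lambda>z. \<Sum>k\<le>N. (\<phi> k z)\<^sup>2"] by blast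
  obtain c0 d0 S0 where z0_eq: "z0 = (c0, d0, S0)" by (cases z0)
  define y where "y k = \<phi> k z0" for k
  show thesis
  proof (cases "(\<Sum>k\<le>N. (y k)\<^sup>2) = 0")
    case True
    then have "\<phi> k z0 = 0" if "k \<le> N" for k
      using that by (simp add: sum_nonneg_eq_0_iff y_def)
    then show ?thesis
      using combination[of c0 d0 S0] z0 unfolding z0_eq in_K by (auto simp: \<phi>_def)
  next
    case False
    then have pos: "0 < (\<Sum>k\<le>N. (y k)\<^sup>2)"
      by (simp add: sum_nonneg order.not_eq_order_implies_strict)
    have le: "(\<Sum>k\<le>N. (y k)\<^sup>2) \<le> (\<Sum>k\<le>N. y k * \<phi> k z)" if "z \<in> K" for z
    proof (rule min_norm_functional)
      fix t :: real assume t: "0 \<le> t" "t \<le> 1"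
      obtain c d S where z: "z = (c, d, S)" by (cases z)
      \<comment> \<open>\<open>K\<close> is convex: the point \<open>w\<close> of the segment from
        \<open>z0\<close> to \<open>z\<close> stays in \<open>K\<close>, so minimality applies to
        it.\<close>
      define w where "w = ((1 - t) * c0 + t * c, (1 - t) * d0 + t * d,
        \<lambda>i j. (1 - t) * S0 i j + t * S i j)"
      have bl: "bilin n (\<lambda>i j. (1 - t) * S0 i j + t * S i j) u u =
          (1 - t) * bilin n S0 u u + t * bilin n S u u" for u
        by (simp add: bilin_def sum.distrib[symmetric] sum_distrib_left algebra_simps)
      have box: "l \<le> (1 - t) * p + t * q \<and> (1 - t) * p + t * q \<le> h"
        if "l \<le> p" "p \<le> h" "l \<le> q" "q \<le> h" for l h p q :: real
        using convex_bound_le[of p h q "1 - t" t] convex_bound_le[of "-p" "-l" "-q" "1 - t" t] that t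
        by simp
      have tr: "(\<Sum>i<n. (1 - t) * S0 i i + t * S i i) =
          (1 - t) * (\<Sum>i<n. S0 i i) + t * (\<Sum>i<n. S i i)"
        by (simp add: sum.distrib sum_distrib_left)
      have "(1 - t) * c0 + t * c + ((1 - t) * d0 + t * d) +
          ((1 - t) * (\<Sum>i<n. S0 i i) + t * (\<Sum>i<n. S i i)) =
          (1 - t) * (c0 + d0 + (\<Sum>i<n. S0 i i)) + t * (c + d + (\<Sum>i<n. S i i))"
        by (simp add: algebra_simps)
      also have "\<dots> = 1"
        using z0 that by (simp add: z z0_eq in_K)
      finally have sum1: "(1 - t) * c0 + t * c + ((1 - t) * d0 + t * d) +
          ((1 - t) * (\<Sum>i<n. S0 i i) + t * (\<Sum>i<n. S i i)) = 1" .
      have "\<forall>i j. (1 - t) * S0 i j + t * S i j = (1 - t) * S0 j i + t * S j i"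
        using z0 that unfolding z z0_eq in_K by metis
      moreover have "\<forall>i j. - 1 \<le> (1 - t) * S0 i j + t * S i j \<and> (1 - t) * S0 i j + t * S i j \<le> 1"
        using z0 that unfolding z z0_eq in_K by (intro allI box) auto
      moreover have "0 \<le> (1 - t) * c0 + t * c \<and> (1 - t) * c0 + t * c \<le> 1"
        "0 \<le> (1 - t) * d0 + t * d \<and> (1 - t) * d0 + t * d \<le> 1"
        using z0 that unfolding z z0_eq in_K by (intro box; simp)+
      moreover have "\<forall>u. 0 \<le> (1 - t) * bilin n S0 u u + t * bilin n S u u"
        using z0 that t unfolding z z0_eq in_K by simp
      ultimately have "w \<in> K"
        using z0 that sum1 unfolding w_def z z0_eq in_K by (simp add: bl tr)
      moreover have "\<phi> k w = (1 - t) * y k + t * \<phi> k z" for k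
        by (simp add: y_def \<phi>_def w_def z z0_eq sum.distrib sum_subtractf sum_distrib_left algebra_simps)
      ultimately show "(\<Sum>k\<le>N. (y k)\<^sup>2) \<le> (\<Sum>k\<le>N. ((1 - t) * y k + t * \<phi> k z)\<^sup>2)"
        using min[of w] by (simp add: y_def)
    qed
    show ?thesis
    proof (rule functional[of y])
      \<comment> \<open>Testing \<open>le\<close> on the triple of the constant 1 gives
        \<open>y 0\<close>; the triple of -f gives the sign at \<open>f\<close>.\<close>
      have "(\<Sum>k\<le>N. y k * \<phi> k (1, 0, \<lambda>_ _. 0)) = (\<Sum>k\<le>N. if k = 0 then y 0 else 0)"
        by (intro sum.cong) (auto simp: \<phi>_def)
      then show "0 < y 0"
        using le[OF K1] pos by simp
      show "(\<Sum>k\<le>N. y k * f k) < 0"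
        using le[OF K2] pos by (simp add: \<phi>_def sum_negf)
    next
      fix u :: "nat \<Rightarrow> real" assume u: "\<And>i. i \<notin> I \<Longrightarrow> u i = 0"
      define T where "T = (\<Sum>i<n. (u i)\<^sup>2)"
      show "0 \<le> bilin n (\<lambda>i j. \<Sum>k\<le>N. y k * a i j k) u u"
      proof (cases "T = 0")
        case True
        then have "u i = 0" if "i < n" for i
          using that by (simp add: T_def sum_nonneg_eq_0_iff)
        then show ?thesis by (simp add: bilin_def)
      next
        case False
        then have T: "0 < T" by (simp add: T_def sum_nonneg order.not_eq_order_implies_strict)
        \<comment> \<open>The test triple for \<open>u\<close> is its rank-one matrix, scaled to
          trace 1.\<close>
        define S where "S i j = u i * u j / T" for i j
        have sq: "(u i)\<^sup>2 \<le> T" for i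
        proof (cases "i \<in> I")
          case True
          then show ?thesis unfolding T_def using I by (intro member_le_sum) auto
        qed (use u T in auto)
        have "\<bar>u i * u j\<bar> \<le> T" for i j
        proof -
          have "2 * \<bar>u i * u j\<bar> \<le> (u i)\<^sup>2 + (u j)\<^sup>2"
            using sum_squares_bound[of "\<bar>u i\<bar>" "\<bar>u j\<bar>"] by (simp add: abs_mult)
          then show ?thesis using sq[of i] sq[of j] by linarith
        qed
        then have "- 1 \<le> S i j \<and> S i j \<le> 1" for i j
          using T by (auto simp: S_def field_simps abs_le_iff minus_le_iff)
        moreover have "bilin n S v v = (\<Sum>i<n. u i * v i) * (\<Sum>i<n. u i * v i) / T" for v
          by (simp add: S_def bilin_def sum_product sum_divide_distrib mult_ac)
        moreover have "(\<Sum>i<n. S i i) = 1"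
          using T by (simp add: S_def T_def power2_eq_square sum_divide_distrib[symmetric])
        ultimately have "(0, 0, S) \<in> K"
          using T u by (auto simp: in_K S_def mult.commute)
        then have "0 < (\<Sum>k\<le>N. y k * \<phi> k (0, 0, S))"
          using le pos by fastforce
        also have "\<dots> = bilin n (\<lambda>i j. \<Sum>k\<le>N. y k * a i j k) u u / T"
        proof -
          have "y k * \<phi> k (0, 0, S) = (\<Sum>i<n. \<Sum>j<n. y k * a i j k * (u i * u j) / T)" for k
            by (simp add: \<phi>_def S_def sum_distrib_left mult_ac)
          then have "(\<Sum>k\<le>N. y k * \<phi> k (0, 0, S)) =
              (\<Sum>i<n. \<Sum>k\<le>N. \<Sum>j<n. y k * a i j k * (u i * u j) / T)"
            by (simp add: sum.swap[of _ _ "{..N}"])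
          also have "\<dots> = (\<Sum>i<n. \<Sum>j<n. \<Sum>k\<le>N. y k * a i j k * (u i * u j) / T)"
            by (intro sum.cong refl sum.swap)
          finally show ?thesis
            by (simp add: bilin_def sum_distrib_right sum_divide_distrib)
        qed
        finally show ?thesis using T by (simp add: zero_less_divide_iff)
      qed
    qed
  qed
qed

section \<open>Polynomials and affine polynomials\<close>

lemma const_poly_simps [simp]: "const_poly 0 = 0" "const_poly 1 = 1"
  by (simp_all add: const_poly_def)

lemma const_poly_hom:
  "const_poly (a + b) = const_poly a + const_poly b"
  "const_poly (a - b) = const_poly a - const_poly b"
  "const_poly (- a) = - const_poly a"
  "const_poly (a * b) = const_poly a * const_poly b"
  by (simp_all add: const_poly_def single_add single_diff single_uminus mult_single)

lemma const_poly_sum: "const_poly (\<Sum>i\<in>B. g i) = (\<Sum>i\<in>B. const_poly (g i))"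
  by (induction B rule: infinite_finite_induct) (simp_all add: const_poly_hom)

section \<open>Closure properties of polynomials of bounded degree\<close>

lemma polys_leD: "p \<in> polys_le n k \<Longrightarrow> p \<in> polys n"
  by (simp add: polys_le_def)

lemma const_poly_in_polys_le [simp]: "const_poly c \<in> polys_le n k"
  by (simp add: polys_le_def polys_def const_poly_def monom_degree_def)

lemma zero_in_polys_le [simp]: "0 \<in> polys_le n k"
  by (simp add: polys_le_def polys_def)

lemma polys_le_add:
  assumes "p \<in> polys_le n k" "q \<in> polys_le n k"
  shows "p + q \<in> polys_le n k"
  using assms keys_add[of p q] unfolding polys_le_def polys_def by blast

lemma polys_le_uminus: "p \<in> polys_le n k \<Longrightarrow> - p \<in> polys_le n k"
  by (simp add: polys_le_def polys_def)

lemma polys_le_sum: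
  "(\<And>i. i \<in> B \<Longrightarrow> g i \<in> polys_le n k) \<Longrightarrow> (\<Sum>i\<in>B. g i) \<in> polys_le n k"
  by (induction B rule: infinite_finite_induct) (auto intro: polys_le_add)

text \<open>Natural exponents cannot cancel, so the union is attained; for real coefficients only an
  inclusion holds.\<close>

lemma keys_add_nat: "Poly_Mapping.keys (a + b :: nat \<Rightarrow>\<^sub>0 nat) = Poly_Mapping.keys a \<union> Poly_Mapping.keys b"
  by (auto simp: in_keys_iff lookup_add)

lemma monom_degree_add: "monom_degree (a + b) = monom_degree a + monom_degree b"
proof -
  let ?K = "Poly_Mapping.keys a \<union> Poly_Mapping.keys b"
  have "(\<Sum>i\<in>?K. Poly_Mapping.lookup m i) = (\<Sum>i\<in>Poly_Mapping.keys m. Poly_Mapping.lookup m i)"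
    if "Poly_Mapping.keys m \<subseteq> ?K" for m :: "nat \<Rightarrow>\<^sub>0 nat"
    using that by (intro sum.mono_neutral_right) (auto simp: in_keys_iff)
  then show ?thesis
    by (simp add: monom_degree_def keys_add_nat lookup_add sum.distrib)
qed

lemma polys_add: "p \<in> polys n \<Longrightarrow> q \<in> polys n \<Longrightarrow> p + q \<in> polys n"
  using keys_add[of p q] unfolding polys_def by blast

lemma polys_sum: "(\<And>i. i \<in> B \<Longrightarrow> g i \<in> polys n) \<Longrightarrow> (\<Sum>i\<in>B. g i) \<in> polys n"
proof (induction B rule: infinite_finite_induct)
  case (insert i B)
  then show ?case by (simp add: polys_add)
qed (simp_all add: polys_def)

lemma polys_mult: "p \<in> polys n \<Longrightarrow> q \<in> polys n \<Longrightarrow> p * q \<in> polys n"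
  using keys_mult[of p q] unfolding polys_def by (fastforce simp: keys_add_nat)

lemma polys_le_mult:
  assumes "p \<in> polys_le n k" "q \<in> polys_le n l"
  shows "p * q \<in> polys_le n (k + l)"
proof -
  have "monom_degree m \<le> k + l" if "m \<in> Poly_Mapping.keys (p * q)" for m
    using that keys_mult[of p q] assms by (fastforce simp: polys_le_def monom_degree_add add_mono)
  then show ?thesis using assms polys_mult by (auto simp: polys_le_def)
qed

section \<open>Evaluation as a ring homomorphism\<close>

abbreviation eval_monom :: "(nat \<Rightarrow>\<^sub>0 nat) \<Rightarrow> real vec \<Rightarrow> real"
  where "eval_monom m x \<equiv> \<Prod>i\<in>Poly_Mapping.keys m. vec_index x i ^ Poly_Mapping.lookup m i"

lemma eval_monom_add: "eval_monom (a + b) x = eval_monom a x * eval_monom b x"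
proof -
  let ?K = "Poly_Mapping.keys a \<union> Poly_Mapping.keys b"
  have "(\<Prod>i\<in>?K. vec_index x i ^ Poly_Mapping.lookup m i) = eval_monom m x"
    if "Poly_Mapping.keys m \<subseteq> ?K" for m
    using that by (intro prod.mono_neutral_right) (auto simp: in_keys_iff)
  then show ?thesis
    by (simp add: keys_add_nat lookup_add power_add prod.distrib)
qed

lemma eval_poly_single: "eval_poly (Poly_Mapping.single m c) x = c * eval_monom m x"
  by (simp add: eval_poly_def)

lemma eval_poly_zero [simp]: "eval_poly 0 x = 0"
  by (simp add: eval_poly_def)

lemma eval_poly_const [simp]: "eval_poly (const_poly c) x = c"
  by (simp add: eval_poly_single const_poly_def)

lemma eval_poly_add: "eval_poly (p + q) x = eval_poly p x + eval_poly q x"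
  unfolding eval_poly_def by (rule setsum_keys_plus_distrib) (auto simp: algebra_simps)

lemma eval_poly_uminus: "eval_poly (- p) x = - eval_poly p x"
  by (simp add: eval_poly_def sum_negf)

lemma eval_poly_diff: "eval_poly (p - q) x = eval_poly p x - eval_poly q x"
  using eval_poly_add[of p "- q" x] by (simp add: eval_poly_uminus)

lemma eval_poly_sum: "eval_poly (\<Sum>i\<in>B. g i) x = (\<Sum>i\<in>B. eval_poly (g i) x)"
  by (induction B rule: infinite_finite_induct) (simp_all add: eval_poly_add)

lemma sum_monomials:
  fixes p :: mpoly
  shows "p = (\<Sum>m\<in>Poly_Mapping.keys p. Poly_Mapping.single m (Poly_Mapping.lookup p m))"
  by (rule poly_mapping_eqI)
    (auto simp: lookup_sum lookup_single when_def in_keys_iff sum.delta)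

lemma eval_poly_mult: "eval_poly (p * q) x = eval_poly p x * eval_poly q x"
proof -
  have "eval_poly (p * q) x = eval_poly
      ((\<Sum>m\<in>Poly_Mapping.keys p. Poly_Mapping.single m (Poly_Mapping.lookup p m)) *
       (\<Sum>m\<in>Poly_Mapping.keys q. Poly_Mapping.single m (Poly_Mapping.lookup q m))) x"
    using sum_monomials by metis
  also have "\<dots> = (\<Sum>k\<in>Poly_Mapping.keys p. \<Sum>m\<in>Poly_Mapping.keys q.
      Poly_Mapping.lookup p k * eval_monom k x * (Poly_Mapping.lookup q m * eval_monom m x))"
    unfolding sum_product by (simp add: eval_poly_sum mult_single eval_poly_single eval_monom_add mult_ac)
  also have "\<dots> = eval_poly p x * eval_poly q x"
    by (simp add: eval_poly_def sum_product)
  finally show ?thesis .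
qed

lemma eval_bilin:
  "eval_poly (bilin n M u v) x =
    bilin n (\<lambda>i j. eval_poly (M i j) x) (\<lambda>i. eval_poly (u i) x) (\<lambda>i. eval_poly (v i) x)"
  by (simp add: bilin_def eval_poly_sum eval_poly_mult)

section \<open>Affine polynomials in coordinates\<close>

text \<open>The affine polynomial \<open>lin n a\<close> has constant coefficient \<open>a 0\<close>, and \<open>a (Suc i)\<close> is the
  coefficient of the variable with index \<open>i\<close>.\<close>

definition basis_poly :: "nat \<Rightarrow> mpoly" where
  "basis_poly k = (case k of 0 \<Rightarrow> 1 | Suc i \<Rightarrow> Poly_Mapping.single (Poly_Mapping.single i 1) 1)"

definition lin :: "nat \<Rightarrow> (nat \<Rightarrow> real) \<Rightarrow> mpoly" where
  "lin n a = (\<Sum>k\<le>n. const_poly (a k) * basis_poly k)"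

lemma lin_in_polys_le [simp]: "lin n a \<in> polys_le n 1"
proof -
  have "basis_poly k \<in> polys_le n 1" if "k \<le> n" for k
    using that by (auto simp: basis_poly_def polys_le_def polys_def monom_degree_def split: nat.split)
  then have "const_poly (a k) * basis_poly k \<in> polys_le n 1" if "k \<le> n" for k
    using polys_le_mult[of "const_poly (a k)" n 0 "basis_poly k" 1] that by simp
  then show ?thesis unfolding lin_def by (intro polys_le_sum) simp
qed

lemma lin_add: "lin n (\<lambda>k. a k + b k) = lin n a + lin n b"
  and lin_diff: "lin n (\<lambda>k. a k - b k) = lin n a - lin n b"
  and lin_scale: "lin n (\<lambda>k. c * a k) = const_poly c * lin n a"
  by (simp_all add: lin_def const_poly_hom sum.distrib sum_subtractf sum_distrib_left algebra_simps)

lemma lin_sum: "lin n (\<lambda>k. \<Sum>i\<in>B. g i k) = (\<Sum>i\<in>B. lin n (g i))"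
  unfolding lin_def by (simp add: const_poly_sum sum_distrib_right) (rule sum.swap)

lemma lin_const: "lin n (\<lambda>k. c * of_bool (k = 0)) = const_poly c"
proof -
  have "lin n (\<lambda>k. c * of_bool (k = 0)) = (\<Sum>k\<le>n. if k = 0 then const_poly c else 0)"
    unfolding lin_def by (intro sum.cong) (auto simp: basis_poly_def)
  then show ?thesis by simp
qed

lemma lin_cong: "(\<And>k. k \<le> n \<Longrightarrow> a k = b k) \<Longrightarrow> lin n a = lin n b"
  by (simp add: lin_def)

lemma eval_lin: "eval_poly (lin n a) x = (\<Sum>k\<le>n. (case k of 0 \<Rightarrow> 1 | Suc i \<Rightarrow> vec_index x i) * a k)"
proof -
  have "eval_poly (basis_poly k) x = (case k of 0 \<Rightarrow> 1 | Suc i \<Rightarrow> vec_index x i)" for k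
    by (auto simp: basis_poly_def eval_poly_single eval_poly_const[of 1, simplified] split: nat.split)
  then show ?thesis by (simp add: lin_def eval_poly_sum eval_poly_mult mult_ac)
qed

text \<open>An exponent of total degree at most 1 is zero or a single variable, so each monomial is
  some \<open>lin n a\<close>, and these are closed under sums.\<close>

lemma affine_eq_lin:
  assumes "p \<in> polys_le n 1"
  shows "\<exists>a. p = lin n a"
proof -
  have mono: "\<exists>a. Poly_Mapping.single m c = lin n a"
    if m: "Poly_Mapping.keys m \<subseteq> {..<n}" "monom_degree m \<le> 1" for m c
  proof (cases "Poly_Mapping.keys m = {}")
    case True
    then have "Poly_Mapping.single m c = lin n (\<lambda>k. c * of_bool (k = 0))"
      unfolding lin_const by (simp add: const_poly_def)
    then show ?thesis by blast
  next
    case False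
    then obtain i where i: "i \<in> Poly_Mapping.keys m" by blast
    have "monom_degree m = Poly_Mapping.lookup m i +
        (\<Sum>j\<in>Poly_Mapping.keys m - {i}. Poly_Mapping.lookup m j)"
      unfolding monom_degree_def using i by (simp add: sum.remove)
    moreover have "1 \<le> Poly_Mapping.lookup m i"
      using i by (simp add: in_keys_iff)
    ultimately have one: "Poly_Mapping.lookup m i = 1"
      and rest: "(\<Sum>j\<in>Poly_Mapping.keys m - {i}. Poly_Mapping.lookup m j) = 0"
      using m(2) by linarith+
    have "m = Poly_Mapping.single i 1"
      using one rest by (intro poly_mapping_eqI) (auto simp: lookup_single when_def in_keys_iff)
    moreover have "lin n (\<lambda>k. c * of_bool (k = Suc i)) =
        (\<Sum>k\<le>n. if k = Suc i then const_poly c * basis_poly (Suc i) else 0)"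
      unfolding lin_def by (intro sum.cong) auto
    ultimately have "Poly_Mapping.single m c = lin n (\<lambda>k. c * of_bool (k = Suc i))"
      using i m(1) by (auto simp: const_poly_def basis_poly_def mult_single Suc_le_eq subset_iff)
    then show ?thesis by blast
  qed
  have "\<forall>m\<in>Poly_Mapping.keys p. \<exists>a. Poly_Mapping.single m (Poly_Mapping.lookup p m) = lin n a"
    using assms mono by (auto simp: polys_le_def polys_def)
  then obtain a where
    "\<And>m. m \<in> Poly_Mapping.keys p \<Longrightarrow> Poly_Mapping.single m (Poly_Mapping.lookup p m) = lin n (a m)"
    by metis
  then have "p = (\<Sum>m\<in>Poly_Mapping.keys p. lin n (a m))"
    using sum_monomials[of p] by simp
  then show ?thesis by (metis lin_sum)
qed

section \<open>Ideals, sums of squares and pencils\<close>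

text \<open>Quantifying over all functions \<open>u\<close> is harmless because the form sees only
  the entries below \<open>n\<close>. All later reasoning uses this version.\<close>

lemma sym_psd_iff:
  "sym_psd n M \<longleftrightarrow> M \<in> carrier_mat n n \<and> (\<forall>i<n. \<forall>j<n. M $$ (i, j) = M $$ (j, i)) \<and>
    (\<forall>u. 0 \<le> bilin n (\<lambda>i j. M $$ (i, j)) u u)"
proof (cases "M \<in> carrier_mat n n")
  case True
  then have d: "dim_row M = n" "dim_col M = n" by auto
  have form: "v \<bullet> (M *\<^sub>v v) = bilin n (\<lambda>i j. M $$ (i, j)) (vec_index v) (vec_index v)"
    if "v \<in> carrier_vec n" for v
    using that d by (simp add: bilin_eq_sum_row scalar_prod_def lessThan_atLeast0)
  have "(\<forall>v\<in>carrier_vec n. 0 \<le> v \<bullet> (M *\<^sub>v v)) \<longleftrightarrow> (\<forall>u. 0 \<le> bilin n (\<lambda>i j. M $$ (i, j)) u u)"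
  proof safe
    fix u assume "\<forall>v\<in>carrier_vec n. 0 \<le> v \<bullet> (M *\<^sub>v v)"
    then have "0 \<le> bilin n (\<lambda>i j. M $$ (i, j)) (vec_index (vec n u)) (vec_index (vec n u))"
      by (metis form vec_carrier)
    then show "0 \<le> bilin n (\<lambda>i j. M $$ (i, j)) u u"
      using bilin_cong[of n "\<lambda>i j. M $$ (i, j)" "\<lambda>i j. M $$ (i, j)" "vec_index (vec n u)" u
          "vec_index (vec n u)" u] by simp
  qed (simp add: form)
  moreover have "transpose_mat M = M \<longleftrightarrow> (\<forall>i<n. \<forall>j<n. M $$ (i, j) = M $$ (j, i))"
    using d by (auto simp: mat_eq_iff)
  ultimately show ?thesis using True by (simp add: sym_psd_def)
qed (simp add: sym_psd_def)

lemma sym_psd_mat: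
  assumes "\<And>i j. S i j = S j i" "\<And>u. 0 \<le> bilin n S u u"
  shows "sym_psd n (mat n n (\<lambda>(i, j). S i j))"
proof -
  have "bilin n (\<lambda>i j. mat n n (\<lambda>(i, j). S i j) $$ (i, j)) u u = bilin n S u u" for u
    by (rule bilin_cong) auto
  then show ?thesis using assms by (simp add: sym_psd_iff)
qed

section \<open>Traces and Gram matrices\<close>

lemma mat_trace_mult:
  assumes "A \<in> carrier_mat n n" "B \<in> carrier_mat n n"
  shows "mat_trace (A * B) = (\<Sum>i<n. \<Sum>j<n. A $$ (i, j) * B $$ (j, i))"
  using assms by (auto simp: mat_trace_def scalar_prod_def lessThan_atLeast0 intro!: sum.cong)

text \<open>This is P^T P for the matrix P with rows \<open>r m\<close>, written without P.\<close>

definition gram :: "nat \<Rightarrow> nat \<Rightarrow> (nat \<Rightarrow> nat \<Rightarrow> 'a::comm_ring_1) \<Rightarrow> 'a mat" where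
  "gram n t r = mat n n (\<lambda>(i, j). \<Sum>m<t. r m i * r m j)"

lemma gram_carrier [simp]: "gram n t r \<in> carrier_mat n n"
  by (simp add: gram_def)

text \<open>Turns the trace against an sos-matrix into a sum of values of the quadratic form of
  \<open>A\<close>, one for each row.\<close>

lemma mat_trace_mult_gram:
  assumes "A \<in> carrier_mat n n"
  shows "mat_trace (A * gram n t r) = (\<Sum>m<t. bilin n (\<lambda>i j. A $$ (i, j)) (r m) (r m))"
proof -
  have "mat_trace (A * gram n t r) = (\<Sum>i<n. \<Sum>j<n. \<Sum>m<t. A $$ (i, j) * (r m i * r m j))"
    using assms by (simp add: mat_trace_mult gram_def sum_distrib_left mult_ac)
  also have "\<dots> = (\<Sum>i<n. \<Sum>m<t. \<Sum>j<n. A $$ (i, j) * (r m i * r m j))"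
    by (intro sum.cong refl sum.swap)
  also have "\<dots> = (\<Sum>m<t. \<Sum>i<n. \<Sum>j<n. A $$ (i, j) * (r m i * r m j))"
    by (rule sum.swap)
  finally show ?thesis by (simp add: bilin_def)
qed

lemma transpose_mult_eq_gram:
  assumes "P \<in> carrier_mat t n"
  shows "transpose_mat P * P = gram n t (\<lambda>m i. P $$ (m, i))"
  using assms by (intro eq_matI) (auto simp: gram_def scalar_prod_def lessThan_atLeast0)

lemma elements_mat_subset_iff:
  "elements_mat M \<subseteq> B \<longleftrightarrow> (\<forall>i<dim_row M. \<forall>j<dim_col M. M $$ (i, j) \<in> B)"
  by (auto simp: elements_mat_def UN_subset_iff image_subset_iff Ball_def)

lemma quadratic_sos_gram:
  assumes "\<And>m i. m < t \<Longrightarrow> i < \<alpha> \<Longrightarrow> r m i \<in> polys_le n 1"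
  shows "quadratic_sos_matrix n \<alpha> (gram \<alpha> t r)"
proof -
  define P where "P = mat t \<alpha> (\<lambda>(m, i). r m i)"
  have "gram \<alpha> t r = transpose_mat P * P"
    by (subst transpose_mult_eq_gram[of _ t]) (auto simp: P_def gram_def intro!: eq_matI sum.cong)
  moreover have "P \<in> carrier_mat t \<alpha>" "elements_mat P \<subseteq> polys n"
    by (auto simp: P_def elements_mat_subset_iff intro!: polys_leD[OF assms])
  moreover have "r m i * r m j \<in> polys_le n 2" if "m < t" "i < \<alpha>" "j < \<alpha>" for m i j
    using polys_le_mult[OF assms assms, of m i m j] that by (simp add: numeral_2_eq_2)
  then have "elements_mat (gram \<alpha> t r) \<subseteq> polys_le n 2"
    by (auto simp: elements_mat_subset_iff gram_def intro!: polys_le_sum)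
  ultimately show ?thesis
    unfolding quadratic_sos_matrix_def sos_matrix_def by blast
qed

section \<open>Ideals generated by lists\<close>

lemma ideal_gen_zero [simp]: "0 \<in> ideal_gen n ps"
  unfolding ideal_gen_def by (rule CollectI, rule exI[of _ "\<lambda>_. 0"]) (simp add: polys_def)

lemma ideal_gen_ConsI:
  assumes "r \<in> ideal_gen n ps" "g \<in> polys n"
  shows "g * p + r \<in> ideal_gen n (p # ps)"
proof -
  obtain q where q: "r = (\<Sum>k<length ps. q k * ps ! k)" "\<forall>k<length ps. q k \<in> polys n"
    using assms(1) by (auto simp: ideal_gen_def)
  have "g * p + r = (\<Sum>k<length (p # ps). case_nat g q k * (p # ps) ! k)"
    by (simp add: q(1) sum.lessThan_Suc_shift del: sum.lessThan_Suc)
  moreover have "\<forall>k<length (p # ps). case_nat g q k \<in> polys n"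
    using q(2) assms(2) by (auto split: nat.split)
  ultimately show ?thesis unfolding ideal_gen_def by blast
qed

lemma ideal_gen_unit:
  assumes "p \<in> polys n" "c \<noteq> 0"
  shows "p \<in> ideal_gen n (const_poly c # ps)"
proof -
  have "p * const_poly (1 / c) \<in> polys n"
    using assms(1) const_poly_in_polys_le polys_leD polys_mult by blast
  from ideal_gen_ConsI[OF ideal_gen_zero this, where ps = ps and p = "const_poly c"] show ?thesis
    using assms(2) by (simp add: mult.assoc const_poly_hom(4)[symmetric])
qed

lemma eval_ideal_gen:
  assumes "p \<in> ideal_gen n ps" "\<And>q. q \<in> set ps \<Longrightarrow> eval_poly q x = 0"
  shows "eval_poly p x = 0"
  using assms by (auto simp: ideal_gen_def eval_poly_sum eval_poly_mult intro!: sum.neutral)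

section \<open>Pencils in coordinates\<close>

abbreviation pencil :: "nat \<Rightarrow> nat \<Rightarrow> (nat \<Rightarrow> nat \<Rightarrow> nat \<Rightarrow> real) \<Rightarrow> mpoly mat" where
  "pencil n \<alpha> a \<equiv> mat \<alpha> \<alpha> (\<lambda>(i, j). lin n (a i j))"

lemma lin_scale_right: "lin n (\<lambda>k. a k * c) = lin n a * const_poly c"
  using lin_scale[of n c a] by (simp add: mult.commute)

lemma bilin_pencil:
  "bilin \<alpha> (\<lambda>i j. lin n (a i j)) (\<lambda>i. const_poly (u i)) (\<lambda>i. const_poly (v i)) =
    lin n (\<lambda>k. bilin \<alpha> (\<lambda>i j. a i j k) u v)"
  by (simp add: bilin_def lin_sum lin_scale_right const_poly_hom)

lemma mat_trace_pencil_const: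
  assumes "\<And>i j. S i j = S j i"
  shows "mat_trace (pencil n \<alpha> a * map_mat const_poly (mat \<alpha> \<alpha> (\<lambda>(i, j). S i j))) =
    lin n (\<lambda>k. \<Sum>i<\<alpha>. \<Sum>j<\<alpha>. a i j k * S i j)"
proof -
  have "mat_trace (pencil n \<alpha> a * map_mat const_poly (mat \<alpha> \<alpha> (\<lambda>(i, j). S i j))) =
      (\<Sum>i<\<alpha>. \<Sum>j<\<alpha>. lin n (a i j) * const_poly (S j i))"
    by (subst mat_trace_mult[of _ \<alpha>]) auto
  then show ?thesis
    unfolding lin_sum lin_scale_right by (metis (no_types, lifting) assms sum.cong)
qed

text \<open>The columns with index in \<open>I\<close> form a basis of the column space, so passing to \<open>I\<close> removes the
  vectors annihilated by the whole pencil, which would otherwise spoil the compactness argument.\<close>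

lemma column_basis:
  fixes a :: "nat \<Rightarrow> nat \<Rightarrow> nat \<Rightarrow> real"
  obtains I where "I \<subseteq> {..<\<alpha>}"
    "\<And>v. \<exists>w. (\<forall>i. i \<notin> I \<longrightarrow> w i = 0) \<and>
      (\<forall>j<\<alpha>. \<forall>k\<le>n. (\<Sum>i<\<alpha>. a j i k * v i) = (\<Sum>i<\<alpha>. a j i k * w i))"
    "\<And>u. \<forall>i. i \<notin> I \<longrightarrow> u i = 0 \<Longrightarrow>
      \<forall>j<\<alpha>. \<forall>k\<le>n. (\<Sum>i<\<alpha>. a j i k * u i) = 0 \<Longrightarrow> \<forall>p. u p = 0"
proof -
  define P where "P I \<longleftrightarrow> I \<subseteq> {..<\<alpha>} \<and> (\<forall>v. \<exists>w. (\<forall>i. i \<notin> I \<longrightarrow> w i = 0) \<and>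
      (\<forall>j<\<alpha>. \<forall>k\<le>n. (\<Sum>i<\<alpha>. a j i k * v i) = (\<Sum>i<\<alpha>. a j i k * w i)))" for I
  have "P {..<\<alpha>}"
    unfolding P_def
  proof (intro conjI allI subset_refl)
    fix v :: "nat \<Rightarrow> real"
    show "\<exists>w. (\<forall>i. i \<notin> {..<\<alpha>} \<longrightarrow> w i = 0) \<and>
        (\<forall>j<\<alpha>. \<forall>k\<le>n. (\<Sum>i<\<alpha>. a j i k * v i) = (\<Sum>i<\<alpha>. a j i k * w i))"
      by (rule exI[of _ "\<lambda>i. if i < \<alpha> then v i else 0"]) auto
  qed
  \<comment> \<open>A spanning index set of least cardinality is taken; minimality will give
    independence.\<close>
  then obtain I where I: "P I" and min: "\<And>J. P J \<Longrightarrow> card I \<le> card J"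
    using ex_has_least_nat[of P _ card] by blast
  have fin: "finite I" using I finite_subset unfolding P_def by blast
  show thesis
  proof (rule that[of I])
    fix u :: "nat \<Rightarrow> real"
    assume supp: "\<forall>i. i \<notin> I \<longrightarrow> u i = 0"
      and kernel: "\<forall>j<\<alpha>. \<forall>k\<le>n. (\<Sum>i<\<alpha>. a j i k * u i) = 0"
    show "\<forall>p. u p = 0"
    proof (rule ccontr)
      assume "\<not> (\<forall>p. u p = 0)"
      then obtain p where p: "u p \<noteq> 0" by blast
      have "P (I - {p})"
        unfolding P_def
      proof (intro conjI allI)
        fix v
        from I obtain w where w: "\<forall>i. i \<notin> I \<longrightarrow> w i = 0"
          "\<forall>j<\<alpha>. \<forall>k\<le>n. (\<Sum>i<\<alpha>. a j i k * v i) = (\<Sum>i<\<alpha>. a j i k * w i)"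
          unfolding P_def by meson
        \<comment> \<open>Subtracting a multiple of the kernel vector \<open>u\<close> clears
          coordinate \<open>p\<close> without changing the image, so \<open>I - {p}\<close> would
          still span.\<close>
        define w' where "w' i = w i - w p / u p * u i" for i
        have "(\<Sum>i<\<alpha>. a j i k * w' i) = (\<Sum>i<\<alpha>. a j i k * w i) - w p / u p * (\<Sum>i<\<alpha>. a j i k * u i)"
          for j k
          by (simp add: w'_def sum_subtractf sum_distrib_left algebra_simps)
        then have "\<forall>j<\<alpha>. \<forall>k\<le>n. (\<Sum>i<\<alpha>. a j i k * v i) = (\<Sum>i<\<alpha>. a j i k * w' i)"
          using w(2) kernel by simp
        moreover have "\<forall>i. i \<notin> I - {p} \<longrightarrow> w' i = 0"
          using w(1) supp p by (auto simp: w'_def)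
        ultimately show "\<exists>w. (\<forall>i. i \<notin> I - {p} \<longrightarrow> w i = 0) \<and>
            (\<forall>j<\<alpha>. \<forall>k\<le>n. (\<Sum>i<\<alpha>. a j i k * v i) = (\<Sum>i<\<alpha>. a j i k * w i))"
          by blast
      next
        show "I - {p} \<subseteq> {..<\<alpha>}" using I unfolding P_def by blast
      qed
      moreover have "p \<in> I" using p supp by blast
      ultimately show False using min[of "I - {p}"] fin
        by (metis card_Diff1_less leD)
    qed
  next
    show "I \<subseteq> {..<\<alpha>}" using I unfolding P_def by blast
  next
    fix v :: "nat \<Rightarrow> real"
    show "\<exists>w. (\<forall>i. i \<notin> I \<longrightarrow> w i = 0) \<and>
        (\<forall>j<\<alpha>. \<forall>k\<le>n. (\<Sum>i<\<alpha>. a j i k * v i) = (\<Sum>i<\<alpha>. a j i k * w i))"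
      using I unfolding P_def by (elim conjE allE)
  qed
qed

section \<open>One step of the certificate\<close>

lemma half_add_half: "const_poly (1 / 2) + const_poly (1 / 2) = 1"
  by (simp add: const_poly_hom[symmetric])

text \<open>The other terms sum to - q m and \<open>h\<close> stands for 1/2, so the claim is ((q -
  1)/2)^2 - ((q + 1)/2)^2 = - q multiplied by q.\<close>

lemma square_lin_of_opposite:
  fixes q :: "nat \<Rightarrow> mpoly" and h :: mpoly
  assumes "finite B" "m \<in> B" "(\<Sum>k\<in>B. q k) = 0" "h + h = 1"
  shows "(q m)\<^sup>2 + (\<Sum>k\<in>B. (h * (if k = m then q m - 1 else q m + 1))\<^sup>2 * q k) = 0"
proof -
  have "(\<Sum>k\<in>B - {m}. (h * (if k = m then q m - 1 else q m + 1))\<^sup>2 * q k) =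
      (h * (q m + 1))\<^sup>2 * (\<Sum>k\<in>B - {m}. q k)"
    unfolding sum_distrib_left by (intro sum.cong) auto
  also have "(\<Sum>k\<in>B - {m}. q k) = - q m"
    using assms(1-3) by (simp add: sum.remove eq_neg_iff_add_eq_0 add.commute)
  finally have "(q m)\<^sup>2 + (\<Sum>k\<in>B. (h * (if k = m then q m - 1 else q m + 1))\<^sup>2 * q k) =
      (q m)\<^sup>2 + (h * (q m - 1))\<^sup>2 * q m - (h * (q m + 1))\<^sup>2 * q m"
    using assms(1,2) by (simp add: sum.remove)
  also have "\<dots> = (q m)\<^sup>2 * (1 - (h + h)\<^sup>2)"
    by (simp add: power2_eq_square algebra_simps)
  finally show ?thesis using assms(4) by simp
qed

lemma polys_le_mult_const: "p \<in> polys_le n k \<Longrightarrow> p * const_poly c \<in> polys_le n k"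
  using polys_le_mult[of p n k "const_poly c" 0] by simp

lemma one_in_polys_le [simp]: "1 \<in> polys_le n k"
  using const_poly_in_polys_le[of 1] by simp

text \<open>The combination of the alternative either expresses \<open>f\<close> directly, or it has \<open>d = 0\<close> and then
  \<open>c\<close> plus a sum of quadratic forms \<open>q m\<close> of the pencil vanishes. If \<open>c = 0\<close> and some \<open>q m\<close> is not
  zero, then both \<open>q m\<close> and \<open>- q m\<close> are sums of such forms, which yields \<open>- (q m)\<^sup>2\<close>. If all of them
  vanish, a vector \<open>u\<close> isotropic for the whole pencil is combined with a unit vector.\<close>

lemma certificate_step:
  fixes a :: "nat \<Rightarrow> nat \<Rightarrow> nat \<Rightarrow> real" and f :: "nat \<Rightarrow> real"
  assumes sym: "\<And>i j. a i j = a j i"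
    and nonneg: "\<And>y. y 0 = 1 \<Longrightarrow> (\<And>u. 0 \<le> bilin \<alpha> (\<lambda>i j. \<Sum>k\<le>n. y k * a i j k) u u) \<Longrightarrow>
      0 \<le> (\<Sum>k\<le>n. y k * f k)"
  obtains
    (direct) S c where "sym_psd \<alpha> S" "0 \<le> c"
      "lin n f = const_poly c + mat_trace (pencil n \<alpha> a * map_mat const_poly S)"
  | (square) b and t :: nat and r and k where "k \<le> n" "b k \<noteq> 0"
      "\<And>k. k \<noteq> 0 \<Longrightarrow> (\<And>i j. a i j k = 0) \<Longrightarrow> b k = 0"
      "\<And>m i. m < t \<Longrightarrow> i < \<alpha> \<Longrightarrow> r m i \<in> polys_le n 1"
      "(lin n b)\<^sup>2 + (\<Sum>m<t. bilin \<alpha> (\<lambda>i j. lin n (a i j)) (r m) (r m)) = 0"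
proof -
  obtain I where I: "I \<subseteq> {..<\<alpha>}"
    and spans: "\<And>v. \<exists>w. (\<forall>i. i \<notin> I \<longrightarrow> w i = 0) \<and>
      (\<forall>j<\<alpha>. \<forall>k\<le>n. (\<Sum>i<\<alpha>. a j i k * v i) = (\<Sum>i<\<alpha>. a j i k * w i))"
    and indep: "\<And>u. \<forall>i. i \<notin> I \<longrightarrow> u i = 0 \<Longrightarrow>
      \<forall>j<\<alpha>. \<forall>k\<le>n. (\<Sum>i<\<alpha>. a j i k * u i) = 0 \<Longrightarrow> \<forall>p. u p = 0"
    by (rule column_basis[of \<alpha> n a], rule that)
  from I show thesis
  proof (cases rule: psd_alternative[where a = a and f = f and N = n])
    case (functional y)
    define M where "M = (\<lambda>i j. \<Sum>k\<le>n. y k * a i j k)"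
    have row: "(\<Sum>j<\<alpha>. M i j * v j) = (\<Sum>k\<le>n. y k * (\<Sum>j<\<alpha>. a i j k * v j))" for i v
      unfolding M_def sum_distrib_right sum_distrib_left
      by (subst sum.swap) (simp add: mult.assoc)
    \<comment> \<open>\<open>M v\<close> depends only on the products of \<open>v\<close> with the
      coefficient matrices, so \<open>v\<close> can be replaced on both sides by a vector supported
      on \<open>I\<close>, where the functional is known to be nonnegative.\<close>
    have psd: "0 \<le> bilin \<alpha> M v v" for v
    proof -
      obtain w where w: "\<forall>i. i \<notin> I \<longrightarrow> w i = 0"
        "\<forall>j<\<alpha>. \<forall>k\<le>n. (\<Sum>i<\<alpha>. a j i k * v i) = (\<Sum>i<\<alpha>. a j i k * w i)"
        using spans[of v] by blast
      then have eq: "bilin \<alpha> M x v = bilin \<alpha> M x w" for x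
        unfolding bilin_eq_sum_row row by simp
      have "bilin \<alpha> M v v = bilin \<alpha> M w v"
        unfolding eq[of v] by (rule bilin_commute) (simp add: M_def sym)
      also have "\<dots> \<ge> 0"
        using functional(3)[of w] w(1) unfolding eq[of w] unfolding M_def by simp
      finally show ?thesis .
    qed
    \<comment> \<open>Scaling to constant coordinate 1 turns the functional into evaluation at a
      point, contradicting its negative value at \<open>f\<close>.\<close>
    have "0 \<le> (\<Sum>k\<le>n. y k / y 0 * f k)"
    proof (rule nonneg)
      fix u
      have "bilin \<alpha> (\<lambda>i j. \<Sum>k\<le>n. y k / y 0 * a i j k) u u = bilin \<alpha> M u u / y 0"
        by (simp add: M_def bilin_def sum_divide_distrib sum_distrib_right)
      then show "0 \<le> bilin \<alpha> (\<lambda>i j. \<Sum>k\<le>n. y k / y 0 * a i j k) u u"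
        using psd functional(1) by simp
    qed (use functional(1) in simp)
    also have "\<dots> = (\<Sum>k\<le>n. y k * f k) / y 0"
      by (simp add: sum_divide_distrib)
    finally show ?thesis
      using functional(1,2) by (simp add: zero_le_divide_iff)
  next
    case (combination c d S)
    show ?thesis
    proof (cases "d = 0")
      case False
      define S' where "S' i j = S i j / d" for i j
      have sym': "S' i j = S' j i" for i j
        using combination(3) by (simp add: S'_def)
      have "bilin \<alpha> S' u u = bilin \<alpha> S u u / d" for u
        by (simp add: bilin_def S'_def sum_divide_distrib)
      then have "0 \<le> bilin \<alpha> S' u u" for u
        using combination(2,4) by simp
      then have "sym_psd \<alpha> (mat \<alpha> \<alpha> (\<lambda>(i, j). S' i j))"
        using sym_psd_mat sym' by blast
      moreover have "0 \<le> c / d"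
        using combination(1,2) by simp
      moreover have "lin n f = lin n (\<lambda>k. c / d * of_bool (k = 0) + (\<Sum>i<\<alpha>. \<Sum>j<\<alpha>. a i j k * S' i j))"
      proof (rule lin_cong)
        fix k assume "k \<le> n"
        then have "f k = (c * of_bool (k = 0) + (\<Sum>i<\<alpha>. \<Sum>j<\<alpha>. a i j k * S i j)) / d"
          using combination(7)[of k] False by (simp add: field_simps)
        then show "f k = c / d * of_bool (k = 0) + (\<Sum>i<\<alpha>. \<Sum>j<\<alpha>. a i j k * S' i j)"
          by (simp add: S'_def add_divide_distrib sum_divide_distrib)
      qed
      then have "lin n f = const_poly (c / d) +
          mat_trace (pencil n \<alpha> a * map_mat const_poly (mat \<alpha> \<alpha> (\<lambda>(i, j). S' i j)))"
        unfolding mat_trace_pencil_const[of S', OF sym'] lin_add lin_const .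
      ultimately show ?thesis by (rule direct)
    next
      case True
      obtain w where w: "\<forall>i<\<alpha>. \<forall>j<\<alpha>. S i j = (\<Sum>m<\<alpha>. w m i * w m j)"
        using psd_decomposition[of \<alpha> S] combination(3,4) by blast
      \<comment> \<open>A diagonal entry of \<open>S\<close> is a sum of squares, so its vanishing
        outside \<open>I\<close> puts every \<open>w m\<close> in the span of
        \<open>I\<close>.\<close>
      have w0: "w m i = 0" if "m < \<alpha>" "i < \<alpha>" "i \<notin> I" for m i
      proof -
        have "(\<Sum>m<\<alpha>. w m i * w m i) = 0"
          using w[rule_format, of i i] combination(5)[of i] that by simp
        then show ?thesis
          using that(1) by (simp add: sum_nonneg_eq_0_iff)
      qed
      define q where "q m = (\<lambda>k. bilin \<alpha> (\<lambda>i j. a i j k) (w m) (w m))" for m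
      have form: "bilin \<alpha> (\<lambda>i j. lin n (a i j)) (\<lambda>i. const_poly (w m i)) (\<lambda>i. const_poly (w m i)) =
          lin n (q m)" for m
        by (simp add: bilin_pencil q_def)
      have q_supp: "q m k = 0" if "\<And>i j. a i j k = 0" for m k
        using that by (simp add: q_def bilin_def)
      have "(\<Sum>m<\<alpha>. q m k) = (\<Sum>i<\<alpha>. \<Sum>j<\<alpha>. a i j k * S i j)" for k
      proof -
        have "(\<Sum>m<\<alpha>. q m k) = (\<Sum>i<\<alpha>. \<Sum>m<\<alpha>. \<Sum>j<\<alpha>. a i j k * (w m i * w m j))"
          unfolding q_def bilin_def by (rule sum.swap)
        also have "\<dots> = (\<Sum>i<\<alpha>. \<Sum>j<\<alpha>. \<Sum>m<\<alpha>. a i j k * (w m i * w m j))"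
          by (intro sum.cong refl sum.swap)
        finally show ?thesis using w by (simp add: sum_distrib_left)
      qed
      then have "c * of_bool (k = 0) + (\<Sum>m<\<alpha>. q m k) = 0" if "k \<le> n" for k
        using combination(7)[of k] that True by simp
      then have "lin n (\<lambda>k. c * of_bool (k = 0) + (\<Sum>m<\<alpha>. q m k)) = lin n (\<lambda>k. 0 * of_bool (k = 0))"
        by (intro lin_cong) simp
      then have total: "const_poly c + (\<Sum>m<\<alpha>. lin n (q m)) = 0"
        by (simp only: lin_add lin_sum lin_const const_poly_simps)
      show ?thesis
      proof (cases "c = 0")
        case False
        show ?thesis
        \<comment> \<open>The constant polynomial sqrt c has square \<open>c\<close>, and
          \<open>total\<close> is then the required identity.\<close>
        proof (rule square[of 0 "\<lambda>k. sqrt c * of_bool (k = 0)" \<alpha> "\<lambda>m i. const_poly (w m i)"])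
          have "(const_poly (sqrt c))\<^sup>2 = const_poly c"
            using combination(1) by (simp add: power2_eq_square const_poly_hom(4)[symmetric])
          then show "(lin n (\<lambda>k. sqrt c * of_bool (k = 0)))\<^sup>2 + (\<Sum>m<\<alpha>. bilin \<alpha> (\<lambda>i j. lin n (a i j))
              (\<lambda>i. const_poly (w m i)) (\<lambda>i. const_poly (w m i))) = 0"
            by (simp add: form lin_const total)
        qed (use False in auto)
      next
        case c0: True
        then have total0: "(\<Sum>m<\<alpha>. lin n (q m)) = 0"
          using total by simp
        show ?thesis
        proof (cases "\<exists>m<\<alpha>. \<exists>k\<le>n. q m k \<noteq> 0")
          case True
          then obtain m k where m: "m < \<alpha>" "k \<le> n" "q m k \<noteq> 0" by blast
          \<comment> \<open>Multipliers from \<open>square_lin_of_opposite\<close>; they scale the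
            constant vectors \<open>w m'\<close> and keep the entries affine.\<close>
          define p where "p m' = const_poly (1 / 2) *
              (if m' = m then lin n (q m) - 1 else lin n (q m) + 1)" for m'
          have p: "p m' \<in> polys_le n 1" for m'
          proof -
            have "lin n (q m) - 1 \<in> polys_le n 1" "lin n (q m) + 1 \<in> polys_le n 1"
              using polys_le_add[OF lin_in_polys_le polys_le_uminus[OF one_in_polys_le]]
                polys_le_add[OF lin_in_polys_le one_in_polys_le] by auto
            then show ?thesis
              unfolding p_def by (auto simp: mult.commute[of "const_poly _"] polys_le_mult_const)
          qed
          show ?thesis
          proof (rule square[of k "q m" \<alpha> "\<lambda>m' i. p m' * const_poly (w m' i)"])
            show "(lin n (q m))\<^sup>2 + (\<Sum>m'<\<alpha>. bilin \<alpha> (\<lambda>i j. lin n (a i j))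
                (\<lambda>i. p m' * const_poly (w m' i)) (\<lambda>i. p m' * const_poly (w m' i))) = 0"
              using square_lin_of_opposite[of "{..<\<alpha>}" m "\<lambda>m. lin n (q m)", OF _ _ total0 half_add_half] m
              by (simp add: bilin_scale_left bilin_scale_right form p_def power2_eq_square mult.assoc)
            show "p m' * const_poly (w m' i) \<in> polys_le n 1" for m' i
              using p polys_le_mult_const by blast
          qed (use m q_supp in auto)
        next
          case False
          \<comment> \<open>All forms \<open>q m\<close> vanish, but \<open>S\<close> has trace 1,
            so some \<open>w m\<close> is a nonzero isotropic vector.\<close>
          have "(\<Sum>i<\<alpha>. S i i) \<noteq> 0"
            using combination(6) True c0 by simp
          then have "\<exists>i\<in>{..<\<alpha>}. S i i \<noteq> 0"
            using sum.neutral[of "{..<\<alpha>}" "\<lambda>i. S i i"] by blast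
          then obtain i where i: "i < \<alpha>" "S i i \<noteq> 0" by blast
          then have "(\<Sum>m<\<alpha>. w m i * w m i) \<noteq> 0"
            using w[rule_format, of i i] by simp
          then have "\<exists>m\<in>{..<\<alpha>}. w m i * w m i \<noteq> 0"
            using sum.neutral[of "{..<\<alpha>}" "\<lambda>m. w m i * w m i"] by blast
          then obtain m where m: "m < \<alpha>" "w m i \<noteq> 0" by auto
          define u where "u i = (if i < \<alpha> then w m i else 0)" for i
          \<comment> \<open>By independence of the columns in \<open>I\<close> the pencil does not
            annihilate \<open>u\<close>, so some entry \<open>L\<close> of A u is a nonzero affine
            polynomial.\<close>
          have "\<exists>j<\<alpha>. \<exists>k\<le>n. (\<Sum>i<\<alpha>. a j i k * u i) \<noteq> 0"
          proof (rule ccontr)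
            assume "\<not> ?thesis"
            moreover have "\<forall>i. i \<notin> I \<longrightarrow> u i = 0"
              using w0 m(1) by (simp add: u_def)
            ultimately have "u i = 0"
              using indep[of u] by blast
            then show False using m(2) i(1) by (simp add: u_def)
          qed
          then obtain j k where jk: "j < \<alpha>" "k \<le> n" "(\<Sum>i<\<alpha>. a j i k * u i) \<noteq> 0" by blast
          define b where "b = (\<lambda>k. \<Sum>i<\<alpha>. a j i k * u i)"
          define e :: "nat \<Rightarrow> mpoly" where "e = (\<lambda>i. of_bool (i = j))"
          define U where "U = (\<lambda>i. const_poly (u i))"
          define L where "L = lin n b"
          \<comment> \<open>At L e + h U the form of \<open>A\<close> equals L^2 (a_jj + 2 h),
            because \<open>U\<close> is isotropic; \<open>h\<close> solves a_jj + 2 h = -1.\<close>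
          define h where "h = const_poly (- 1 / 2) * (lin n (a j j) + 1)"
          let ?A = "\<lambda>i j. lin n (a i j)"
          have eU: "bilin \<alpha> ?A e U = L"
            unfolding bilin_eq_sum_row e_def sum_mult_unit(1)[OF jk(1)] U_def L_def b_def
            by (simp add: lin_sum lin_scale_right)
          have Ue: "bilin \<alpha> ?A U e = L"
            using eU by (subst bilin_commute) (simp_all add: sym)
          have ee: "bilin \<alpha> ?A e e = lin n (a j j)"
            unfolding e_def by (rule bilin_unit[OF jk(1) jk(1)])
          have "bilin \<alpha> ?A U U = lin n (q m)"
            unfolding form[symmetric] by (rule bilin_cong) (simp_all add: U_def u_def)
          also have "\<dots> = lin n (\<lambda>k. 0 * of_bool (k = 0))"
            using False m(1) by (intro lin_cong) auto
          finally have UU: "bilin \<alpha> ?A U U = 0"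
            by (simp only: lin_const const_poly_simps)
          have hh: "h + h = - (lin n (a j j) + 1)"
            unfolding h_def distrib_right[symmetric] const_poly_hom(1)[symmetric]
            by (simp add: const_poly_hom)
          have "L\<^sup>2 + bilin \<alpha> ?A (\<lambda>i. L * e i + h * U i) (\<lambda>i. L * e i + h * U i) =
              L\<^sup>2 + L * L * lin n (a j j) + (h + h) * L * L"
            by (simp add: bilin_add_left bilin_add_right bilin_scale_left bilin_scale_right
                eU Ue ee UU algebra_simps)
          also have "\<dots> = 0"
            unfolding hh by (simp add: power2_eq_square algebra_simps)
          finally have zero: "L\<^sup>2 + bilin \<alpha> ?A (\<lambda>i. L * e i + h * U i) (\<lambda>i. L * e i + h * U i) = 0" .
          have h: "h \<in> polys_le n 1"
            using polys_le_mult_const[OF polys_le_add[OF lin_in_polys_le one_in_polys_le]]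
            by (simp add: h_def mult.commute)
          have aff: "L * e i + h * U i \<in> polys_le n 1" for i
          proof -
            have "L * e i \<in> polys_le n 1"
              using lin_in_polys_le[of n b] by (cases "i = j") (simp_all add: e_def L_def)
            then show ?thesis
              unfolding U_def using h polys_le_mult_const polys_le_add by blast
          qed
          show ?thesis
          proof (rule square[of k b 1 "\<lambda>_ i. L * e i + h * U i"])
            show "(lin n b)\<^sup>2 + (\<Sum>m<1::nat. bilin \<alpha> ?A (\<lambda>i. L * e i + h * U i) (\<lambda>i. L * e i + h * U i)) = 0"
              using zero by (simp add: L_def)
          qed (use jk aff in \<open>auto simp: b_def\<close>)
        qed
      qed
    qed
  qed
qed

section \<open>Induction on the variables\<close>

text \<open>The number \<open>N\<close> of steps is separate from \<open>n\<close>: the induction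
  shortens the list but stays in the ring of \<open>n\<close> variables. Indices start at 0.\<close>

definition certificate ::
    "nat \<Rightarrow> nat \<Rightarrow> mpoly mat \<Rightarrow> mpoly \<Rightarrow> nat \<Rightarrow> (nat \<Rightarrow> mpoly) \<Rightarrow> (nat \<Rightarrow> mpoly mat) \<Rightarrow> real mat \<Rightarrow> real \<Rightarrow> bool"
  where "certificate n \<alpha> A f N l Q S c \<longleftrightarrow>
    (\<forall>i<N. l i \<in> polys_le n 1 \<and> quadratic_sos_matrix n \<alpha> (Q i) \<and>
      (l i)\<^sup>2 + mat_trace (A * Q i) \<in> ideal_gen n (map l [0..<i])) \<and>
    sym_psd \<alpha> S \<and> 0 \<le> c \<and>
    f - const_poly c - mat_trace (A * map_mat const_poly S) \<in> ideal_gen n (map l [0..<N])"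

lemma quadratic_sos_carrier: "quadratic_sos_matrix n \<alpha> Q \<Longrightarrow> Q \<in> carrier_mat \<alpha> \<alpha>"
  by (auto simp: quadratic_sos_matrix_def sos_matrix_def)

lemma mat_trace_mult_in_polys:
  assumes "A \<in> carrier_mat n n" "B \<in> carrier_mat n n"
    "\<And>i j. i < n \<Longrightarrow> j < n \<Longrightarrow> A $$ (i, j) \<in> polys k" "\<And>i j. i < n \<Longrightarrow> j < n \<Longrightarrow> B $$ (i, j) \<in> polys k"
  shows "mat_trace (A * B) \<in> polys k"
  using assms by (auto simp: mat_trace_mult intro!: polys_sum polys_mult)

lemma mat_trace_gram_zero: "A \<in> carrier_mat n n \<Longrightarrow> mat_trace (A * gram n 0 r) = 0"
  by (simp add: mat_trace_mult_gram)

text \<open>A direct representation of \<open>f\<close> is padded to any length by zero polynomials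
  and Gram matrices with no rows.\<close>

lemma certificate_of_const:
  assumes "lin n f = const_poly c + mat_trace (pencil n \<alpha> a * map_mat const_poly S)"
    "sym_psd \<alpha> S" "0 \<le> c"
  shows "certificate n \<alpha> (pencil n \<alpha> a) (lin n f) N (\<lambda>_. 0) (\<lambda>_. gram \<alpha> 0 (\<lambda>_ _. 0)) S c"
  using assms by (simp add: certificate_def mat_trace_gram_zero quadratic_sos_gram)

lemma certificate_case_nat:
  "certificate n \<alpha> A f (Suc N) (case_nat p l) (case_nat B Q) S c \<longleftrightarrow>
    p \<in> polys_le n 1 \<and> quadratic_sos_matrix n \<alpha> B \<and> p\<^sup>2 + mat_trace (A * B) \<in> ideal_gen n [] \<and>
    (\<forall>i<N. l i \<in> polys_le n 1 \<and> quadratic_sos_matrix n \<alpha> (Q i) \<and>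
      (l i)\<^sup>2 + mat_trace (A * Q i) \<in> ideal_gen n (p # map l [0..<i])) \<and>
    sym_psd \<alpha> S \<and> 0 \<le> c \<and>
    f - const_poly c - mat_trace (A * map_mat const_poly S) \<in> ideal_gen n (p # map l [0..<N])"
proof -
  have "map (case_nat p l) [0..<Suc i] = p # map l [0..<i]" for i
    by (simp add: map_upt_Suc del: upt_Suc)
  then show ?thesis by (simp add: certificate_def All_less_Suc2 del: upt_Suc)
qed

text \<open>A nonzero constant generates the whole ring, so the remaining entries can be zero and
  \<open>f\<close> itself lies in the ideal.\<close>

lemma certificate_of_unit:
  assumes "b 0 \<noteq> 0" "lin n b = const_poly (b 0)"
    "\<And>m i. m < t \<Longrightarrow> i < \<alpha> \<Longrightarrow> r m i \<in> polys_le n 1"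
    "(lin n b)\<^sup>2 + mat_trace (pencil n \<alpha> a * gram \<alpha> t r) = 0"
  shows "certificate n \<alpha> (pencil n \<alpha> a) (lin n f) (Suc N) (case_nat (lin n b) (\<lambda>_. 0))
    (case_nat (gram \<alpha> t r) (\<lambda>_. gram \<alpha> 0 (\<lambda>_ _. 0))) (0\<^sub>m \<alpha> \<alpha>) 0"
proof -
  have psd: "sym_psd \<alpha> (0\<^sub>m \<alpha> \<alpha>)"
    using sym_psd_mat[of "\<lambda>_ _. 0" \<alpha>] by (simp add: bilin_def zero_mat_def split_def)
  have "mat_trace (pencil n \<alpha> a * map_mat const_poly (0\<^sub>m \<alpha> \<alpha>)) = 0"
    by (subst mat_trace_mult[of _ \<alpha>]) auto
  moreover have "lin n f \<in> ideal_gen n (const_poly (b 0) # ps)" for ps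
    by (rule ideal_gen_unit[OF polys_leD[OF lin_in_polys_le] assms(1)])
  ultimately show ?thesis
    using assms psd lin_in_polys_le[of n b] quadratic_sos_gram[of t \<alpha> r n]
      quadratic_sos_gram[of 0 \<alpha> "\<lambda>_ _. 0" n]
    unfolding certificate_case_nat by (simp add: mat_trace_gram_zero)
qed

text \<open>Substituting for the \<open>j\<close>-th variable a solution of \<open>lin n b = 0\<close> changes affine polynomials by
  constant multiples of \<open>lin n b\<close>, so no substitution homomorphism is needed.\<close>

lemma certificate_Cons:
  assumes cert: "certificate n \<alpha> (pencil n \<alpha> (\<lambda>i i' k. a i i' k - a i i' j / b j * b k))
      (lin n (\<lambda>k. f k - f j / b j * b k)) N l Q S c"
    and r: "\<And>m i. m < t \<Longrightarrow> i < \<alpha> \<Longrightarrow> r m i \<in> polys_le n 1"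
    and square: "(lin n b)\<^sup>2 + mat_trace (pencil n \<alpha> a * gram \<alpha> t r) = 0"
  shows "certificate n \<alpha> (pencil n \<alpha> a) (lin n f) (Suc N) (case_nat (lin n b) l)
    (case_nat (gram \<alpha> t r) Q) S c"
proof -
  let ?A' = "pencil n \<alpha> (\<lambda>i i' k. a i i' k - a i i' j / b j * b k)"
  \<comment> \<open>Entrywise quotient by \<open>lin n b\<close>, so that A = g * lin n b + A' with
    the reduced pencil A'.\<close>
  define g where "g = mat \<alpha> \<alpha> (\<lambda>(i, i'). const_poly (a i i' j / b j))"
  have trace: "mat_trace (pencil n \<alpha> a * B) = mat_trace (g * B) * lin n b + mat_trace (?A' * B)"
    if "B \<in> carrier_mat \<alpha> \<alpha>" for B
  proof -
    have "mat_trace (pencil n \<alpha> a * B) = (\<Sum>i<\<alpha>. \<Sum>i'<\<alpha>. lin n (a i i') * B $$ (i', i))"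
      using that by (subst mat_trace_mult[of _ \<alpha>]) auto
    also have "\<dots> = (\<Sum>i<\<alpha>. \<Sum>i'<\<alpha>. const_poly (a i i' j / b j) * B $$ (i', i) * lin n b +
        lin n (\<lambda>k. a i i' k - a i i' j / b j * b k) * B $$ (i', i))"
      unfolding lin_diff lin_scale by (simp add: algebra_simps)
    also have "\<dots> = mat_trace (g * B) * lin n b + mat_trace (?A' * B)"
      using that mat_trace_mult[of g \<alpha> B] mat_trace_mult[of ?A' \<alpha> B]
      by (simp add: g_def sum.distrib sum_distrib_right)
    finally show ?thesis .
  qed
  have g_polys: "mat_trace (g * B) \<in> polys n"
    if "B \<in> carrier_mat \<alpha> \<alpha>" "elements_mat B \<subseteq> polys n" for B
    using that polys_leD[OF const_poly_in_polys_le]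
    by (intro mat_trace_mult_in_polys[of _ \<alpha>]) (auto simp: g_def elements_mat_subset_iff)
  have S: "map_mat const_poly S \<in> carrier_mat \<alpha> \<alpha>" "elements_mat (map_mat const_poly S) \<subseteq> polys n"
    using cert polys_leD[OF const_poly_in_polys_le]
    by (auto simp: certificate_def sym_psd_iff elements_mat_subset_iff)
  have "(l i)\<^sup>2 + mat_trace (pencil n \<alpha> a * Q i) \<in> ideal_gen n (lin n b # map l [0..<i])"
    if "i < N" for i
  proof -
    have Q: "quadratic_sos_matrix n \<alpha> (Q i)" using cert that by (simp add: certificate_def)
    then have "Q i \<in> carrier_mat \<alpha> \<alpha>" "elements_mat (Q i) \<subseteq> polys n"
      using quadratic_sos_carrier polys_leD by (auto simp: quadratic_sos_matrix_def)
    moreover from cert that have "(l i)\<^sup>2 + mat_trace (?A' * Q i) \<in> ideal_gen n (map l [0..<i])"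
      unfolding certificate_def by blast
    ultimately have "mat_trace (g * Q i) * lin n b + ((l i)\<^sup>2 + mat_trace (?A' * Q i)) \<in>
        ideal_gen n (lin n b # map l [0..<i])"
      by (intro ideal_gen_ConsI g_polys)
    then show ?thesis
      unfolding trace[OF \<open>Q i \<in> carrier_mat \<alpha> \<alpha>\<close>] by (simp only: add.left_commute)
  qed
  moreover have "lin n f - const_poly c - mat_trace (pencil n \<alpha> a * map_mat const_poly S) \<in>
      ideal_gen n (lin n b # map l [0..<N])"
  proof -
    \<comment> \<open>The coefficient of \<open>lin n b\<close> in the final membership collects the
      quotients of \<open>f\<close> and of the trace.\<close>
    define h where "h = const_poly (f j / b j) - mat_trace (g * map_mat const_poly S)"
    have "const_poly (f j / b j) + - mat_trace (g * map_mat const_poly S) \<in> polys n"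
      using polys_leD[OF const_poly_in_polys_le] g_polys[OF S]
      by (intro polys_add) (auto simp: polys_def)
    then have "h \<in> polys n" by (simp add: h_def)
    moreover from cert have "lin n (\<lambda>k. f k - f j / b j * b k) - const_poly c -
        mat_trace (?A' * map_mat const_poly S) \<in> ideal_gen n (map l [0..<N])"
      unfolding certificate_def by blast
    ultimately have "h * lin n b + (lin n (\<lambda>k. f k - f j / b j * b k) - const_poly c -
        mat_trace (?A' * map_mat const_poly S)) \<in> ideal_gen n (lin n b # map l [0..<N])"
      by (intro ideal_gen_ConsI)
    moreover have "(x - y) * p + ((p' - x * p) - v - z) = p' - v - (y * p + z)"
      for p p' v x y z :: mpoly
      by (simp add: algebra_simps)
    ultimately show ?thesis
      unfolding h_def trace[OF S(1)] lin_diff[of n f] lin_scale by (simp only:)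
  qed
  ultimately show ?thesis
    using cert[unfolded certificate_def] square lin_in_polys_le[of n b]
      quadratic_sos_gram[of t \<alpha> r n] r
    unfolding certificate_case_nat by simp
qed

text \<open>\<open>X\<close> holds the coefficient indices of the variables that still occur. The
  last assumption is nonnegativity of \<open>f\<close> on the spectrahedron, with points written as
  coefficient functionals \<open>y\<close>. Each step removes an element of \<open>X\<close> or ends
  the induction.\<close>

lemma certificate_exists:
  assumes "X \<subseteq> {1..n}" and "\<And>i j. a i j = a j i"
    and "\<And>i j k. k \<notin> insert 0 X \<Longrightarrow> a i j k = 0" and "\<And>k. k \<notin> insert 0 X \<Longrightarrow> f k = 0"
    and "\<And>y. y 0 = 1 \<Longrightarrow> (\<And>u. 0 \<le> bilin \<alpha> (\<lambda>i j. \<Sum>k\<le>n. y k * a i j k) u u) \<Longrightarrow>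
      0 \<le> (\<Sum>k\<le>n. y k * f k)"
  shows "\<exists>l Q S c. certificate n \<alpha> (pencil n \<alpha> a) (lin n f) (card X) l Q S c"
  using assms
proof (induction "card X" arbitrary: X a f)
  case 0
  then have X: "X = {}" using finite_subset[of X "{1..n}"] by simp
  have const: "v = (\<lambda>k. v 0 * of_bool (k = 0))" if "\<And>k. k \<noteq> 0 \<Longrightarrow> v k = 0" for v :: "nat \<Rightarrow> real"
    using that by auto
  have f: "lin n f = const_poly (f 0)"
    using 0(5) X const[of f] lin_const[of n "f 0"] by simp
  have eval: "(\<Sum>k\<le>n. of_bool (k = 0) * v k) = v 0" for v :: "nat \<Rightarrow> real"
    using sum_mult_unit(1)[of 0 "Suc n" v] by (simp add: lessThan_Suc_atMost)
  show ?case
  proof (cases "0 \<le> f 0")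
    case True
    have "sym_psd \<alpha> (mat \<alpha> \<alpha> (\<lambda>(i, j). 0))"
      by (rule sym_psd_mat) (simp_all add: bilin_def)
    moreover have "lin n f = const_poly (f 0) +
        mat_trace (pencil n \<alpha> a * map_mat const_poly (mat \<alpha> \<alpha> (\<lambda>(i, j). 0)))"
      by (subst mat_trace_pencil_const) (use lin_const[of n 0] in \<open>simp_all add: f\<close>)
    ultimately show ?thesis using certificate_of_const True by blast
  next
    case False
    \<comment> \<open>Without variables the pencil and \<open>f\<close> are constant, so a negative
      \<open>f\<close> forces the pencil to fail positive semidefiniteness.\<close>
    then have "\<not> (\<forall>u. 0 \<le> bilin \<alpha> (\<lambda>i j. a i j 0) u u)"
      using 0(6)[of "\<lambda>k. of_bool (k = 0)"] unfolding eval by auto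
    then obtain u where u: "bilin \<alpha> (\<lambda>i j. a i j 0) u u < 0" by (auto simp: not_le)
    \<comment> \<open>Both numbers are negative, so a positive multiple of the rank-one matrix of
      \<open>u\<close> has trace exactly \<open>f\<close> against the pencil.\<close>
    define s where "s = f 0 / bilin \<alpha> (\<lambda>i j. a i j 0) u u"
    have s: "0 < s" using u False by (simp add: s_def divide_neg_neg)
    define S where "S = (\<lambda>i j. s * (u i * u j))"
    have "bilin \<alpha> S v v = s * ((\<Sum>i<\<alpha>. u i * v i) * (\<Sum>i<\<alpha>. u i * v i))" for v
      by (simp add: S_def bilin_def sum_product sum_distrib_left mult_ac)
    then have "sym_psd \<alpha> (mat \<alpha> \<alpha> (\<lambda>(i, j). S i j))"
      using s by (intro sym_psd_mat) (simp_all add: S_def mult_ac)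
    moreover have "lin n f = const_poly 0 +
        mat_trace (pencil n \<alpha> a * map_mat const_poly (mat \<alpha> \<alpha> (\<lambda>(i, j). S i j)))"
    proof (subst mat_trace_pencil_const)
      have "(\<Sum>i<\<alpha>. \<Sum>j<\<alpha>. a i j k * S i j) = f k" for k
      proof (cases "k = 0")
        case True
        have "(\<Sum>i<\<alpha>. \<Sum>j<\<alpha>. a i j k * S i j) = s * bilin \<alpha> (\<lambda>i j. a i j k) u u"
          by (simp add: S_def bilin_def sum_distrib_left mult_ac)
        then show ?thesis using u True by (simp add: s_def)
      next
        case False
        then show ?thesis using 0(4,5) X by simp
      qed
      then show "lin n f = const_poly 0 + lin n (\<lambda>k. \<Sum>i<\<alpha>. \<Sum>j<\<alpha>. a i j k * S i j)" by simp
    qed (simp add: S_def mult_ac)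
    ultimately show ?thesis using certificate_of_const by blast
  qed
next
  case (Suc N)
  have X: "finite X" "0 \<notin> X" using Suc.prems(1) finite_subset by auto
  show ?case
  proof (rule certificate_step[of a \<alpha> n f])
    show "a i j = a j i" for i j by (rule Suc.prems(2))
    show "0 \<le> (\<Sum>k\<le>n. y k * f k)"
      if "y 0 = 1" "\<And>u. 0 \<le> bilin \<alpha> (\<lambda>i j. \<Sum>k\<le>n. y k * a i j k) u u" for y
      using that by (rule Suc.prems(5))
  next
    fix S c
    assume "sym_psd \<alpha> S" "0 \<le> c"
      "lin n f = const_poly c + mat_trace (pencil n \<alpha> a * map_mat const_poly S)"
    then show ?thesis using certificate_of_const by blast
  next
    fix b :: "nat \<Rightarrow> real" and t :: nat and r :: "nat \<Rightarrow> nat \<Rightarrow> mpoly" and k :: nat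
    assume square: "k \<le> n" "b k \<noteq> 0"
      "\<And>k. k \<noteq> 0 \<Longrightarrow> (\<And>i j. a i j k = 0) \<Longrightarrow> b k = 0"
      "\<And>m i. m < t \<Longrightarrow> i < \<alpha> \<Longrightarrow> r m i \<in> polys_le n 1"
      "(lin n b)\<^sup>2 + (\<Sum>m<t. bilin \<alpha> (\<lambda>i j. lin n (a i j)) (r m) (r m)) = 0"
    have b_supp: "b k = 0" if "k \<notin> insert 0 X" for k
      by (rule square(3)) (use Suc.prems(3) that in auto)
    have sq: "(lin n b)\<^sup>2 + mat_trace (pencil n \<alpha> a * gram \<alpha> t r) = 0"
    proof -
      have "bilin \<alpha> (\<lambda>i j. pencil n \<alpha> a $$ (i, j)) (r m) (r m) =
          bilin \<alpha> (\<lambda>i j. lin n (a i j)) (r m) (r m)" for m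
        by (rule bilin_cong) auto
      then show ?thesis using square(5) by (simp add: mat_trace_mult_gram)
    qed
    show ?thesis
    proof (cases "\<exists>j\<in>X. b j \<noteq> 0")
      case False
      then have "k = 0" using square(2) b_supp by blast
      moreover have "lin n b = const_poly (b 0)"
        unfolding lin_const[of n "b 0", symmetric] using b_supp False by (intro lin_cong) auto
      ultimately show ?thesis
        using certificate_of_unit[of b n t \<alpha> r a f N] square(2,4) sq Suc.hyps(2) by metis
    next
      case True
      then obtain j where j: "j \<in> X" "b j \<noteq> 0" by blast
      then have j': "j \<noteq> 0" "j \<le> n" using X Suc.prems(1) by auto
      have N: "N = card (X - {j})" using Suc.hyps(2) j(1) X by simp
      \<comment> \<open>Elimination of variable \<open>j\<close> on coefficients: coefficient
        \<open>j\<close> of \<open>red v\<close> is 0.\<close>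
      define red where "red v k = v k - v j / b j * b k" for v :: "nat \<Rightarrow> real" and k
      have red_supp: "red v k = 0"
        if "\<And>k. k \<notin> insert 0 X \<Longrightarrow> v k = 0" "k \<notin> insert 0 (X - {j})" for v k
        using that b_supp j(2) by (cases "k = j") (auto simp: red_def)
      have "\<exists>l Q S c. certificate n \<alpha> (pencil n \<alpha> (\<lambda>i i'. red (a i i'))) (lin n (red f))
          (card (X - {j})) l Q S c"
      proof (rule Suc.hyps(1))
        show "N = card (X - {j})" by (rule N)
        show "X - {j} \<subseteq> {1..n}" using Suc.prems(1) by blast
        show "red (a i i') = red (a i' i)" for i i' using Suc.prems(2)[of i i'] by simp
        show "red (a i i') k = 0" if "k \<notin> insert 0 (X - {j})" for i i' k
          by (rule red_supp[OF Suc.prems(3) that])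
        show "red f k = 0" if "k \<notin> insert 0 (X - {j})" for k
          by (rule red_supp[OF Suc.prems(4) that])
      next
        fix y :: "nat \<Rightarrow> real"
        assume y: "y 0 = 1" "\<And>u. 0 \<le> bilin \<alpha> (\<lambda>i i'. \<Sum>k\<le>n. y k * red (a i i') k) u u"
        \<comment> \<open>Changing coordinate \<open>j\<close> lifts \<open>y\<close> to the zero
          set of \<open>lin n b\<close>, where reduction changes no values; \<open>z 0\<close> stays
          1 since \<open>j\<close> is not 0.\<close>
        define z where "z = y(j := y j - (\<Sum>k\<le>n. y k * b k) / b j)"
        have "(\<Sum>k\<le>n. z k * v k) = (\<Sum>k\<le>n. y k * red v k)" for v
        proof -
          have "(\<Sum>k\<le>n. z k * v k) = (\<Sum>k\<le>n. y k * v k - (\<Sum>k\<le>n. y k * b k) / b j * v j * of_bool (k = j))"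
            by (intro sum.cong) (auto simp: z_def algebra_simps)
          also have "\<dots> = (\<Sum>k\<le>n. y k * v k) - (\<Sum>k\<le>n. y k * b k) / b j * v j"
            using j' sum_mult_unit(2)[of j "Suc n" "\<lambda>_. (\<Sum>k\<le>n. y k * b k) / b j * v j"]
            by (simp add: sum_subtractf lessThan_Suc_atMost)
          also have "\<dots> = (\<Sum>k\<le>n. y k * red v k)"
            by (simp add: red_def sum_subtractf sum_distrib_left sum_divide_distrib algebra_simps)
          finally show ?thesis .
        qed
        then show "0 \<le> (\<Sum>k\<le>n. y k * red f k)"
          using Suc.prems(5)[of z] y j' by (simp add: z_def)
      qed
      then obtain l Q S c where "certificate n \<alpha> (pencil n \<alpha> (\<lambda>i i' k. a i i' k - a i i' j / b j * b k))
          (lin n (\<lambda>k. f k - f j / b j * b k)) N l Q S c"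
        unfolding N[symmetric] red_def[abs_def] by blast
      from certificate_Cons[OF this square(4) sq] show ?thesis
        using Suc.hyps(2) by metis
    qed
  qed
qed

section \<open>Passage between points and coefficients, and the equivalence\<close>

lemma eval_mat_trace_gram_nonneg:
  assumes "x \<in> spectrahedron n \<alpha> A" "A \<in> carrier_mat \<alpha> \<alpha>"
  shows "0 \<le> eval_poly (mat_trace (A * gram \<alpha> t r)) x"
proof -
  have "bilin \<alpha> (\<lambda>i j. eval_poly (A $$ (i, j)) x) u u =
      bilin \<alpha> (\<lambda>i j. map_mat (\<lambda>p. eval_poly p x) A $$ (i, j)) u u" for u
    using assms(2) by (intro bilin_cong) auto
  then show ?thesis
    using assms
    by (auto simp: mat_trace_mult_gram eval_poly_sum eval_bilin spectrahedron_def sym_psd_iff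
        intro!: sum_nonneg)
qed

lemma pencil_of_linear_pencil:
  assumes "linear_pencil n \<alpha> A"
  obtains a where "A = pencil n \<alpha> a" "\<And>i j. a i j = a j i" "\<And>i j k. n < k \<Longrightarrow> a i j k = 0"
proof -
  have A: "A \<in> carrier_mat \<alpha> \<alpha>" "transpose_mat A = A" "elements_mat A \<subseteq> polys_le n 1"
    using assms by (auto simp: linear_pencil_def)
  have "\<forall>i j. \<exists>v. i < \<alpha> \<and> j < \<alpha> \<longrightarrow> A $$ (i, j) = lin n v"
    using A(1,3) affine_eq_lin unfolding elements_mat_subset_iff by (metis carrier_matD)
  then obtain a where a: "\<And>i j. i < \<alpha> \<Longrightarrow> j < \<alpha> \<Longrightarrow> A $$ (i, j) = lin n (a i j)"
    by metis
  have sym: "A $$ (i, j) = A $$ (j, i)" if "i < \<alpha>" "j < \<alpha>" for i j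
    using A(1,2) that by (metis carrier_matD index_transpose_mat(1))
  \<comment> \<open>The coefficients were chosen entry by entry; reading them from one triangle
    makes them symmetric, and cutting at \<open>n\<close> gives the support condition.\<close>
  define a' where "a' i j k = (if k \<le> n then a (min i j) (max i j) k else 0)" for i j k
  have "lin n (a' i j) = A $$ (i, j)" if "i < \<alpha>" "j < \<alpha>" for i j
  proof -
    have "lin n (a' i j) = lin n (a (min i j) (max i j))"
      by (rule lin_cong) (simp add: a'_def)
    then show ?thesis
      using that a sym by (cases "i \<le> j") (simp_all add: min_def max_def)
  qed
  then have "A = pencil n \<alpha> a'"
    using A(1) by (intro eq_matI) auto
  then show thesis
    by (rule that) (auto simp: a'_def min.commute max.commute)
qed

theorem theorem3p4p1:
  fixes n \<alpha> :: nat and A :: "mpoly mat" and f :: mpoly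
  assumes "linear_pencil n \<alpha> A"
    and "f \<in> polys_le n 1"
  shows "(\<forall>x \<in> spectrahedron n \<alpha> A. 0 \<le> eval_poly f x) \<longleftrightarrow>
    (\<exists>(l :: nat \<Rightarrow> mpoly) (Q :: nat \<Rightarrow> mpoly mat) (S :: real mat) (c :: real).
       (\<forall>i \<in> {1..n}. l i \<in> polys_le n 1) \<and>
       (\<forall>i \<in> {1..n}. quadratic_sos_matrix n \<alpha> (Q i)) \<and>
       sym_psd \<alpha> S \<and> 0 \<le> c \<and>
       (\<forall>i \<in> {1..n}. (l i)\<^sup>2 + mat_trace (A * Q i) \<in> ideal_gen n (map l [1..<i])) \<and>
       f - const_poly c - mat_trace (A * map_mat const_poly S)
         \<in> ideal_gen n (map l [1..<Suc n]))"
    (is "?L \<longleftrightarrow> (\<exists>l Q S c. ?R l Q S c)")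
proof
  assume L: ?L
  obtain a where A: "A = pencil n \<alpha> a" and sym: "\<And>i j. a i j = a j i"
    and supp: "\<And>i j k. n < k \<Longrightarrow> a i j k = 0"
    using pencil_of_linear_pencil[OF assms(1)] by metis
  obtain g where "f = lin n g"
    using affine_eq_lin[OF assms(2)] by blast
  then have f: "f = lin n (\<lambda>k. if k \<le> n then g k else 0)" (is "f = lin n ?f")
    using lin_cong[of n g ?f] by simp
  have "\<exists>l Q S c. certificate n \<alpha> (pencil n \<alpha> a) (lin n ?f) (card {1..n}) l Q S c"
  proof (rule certificate_exists)
    fix y :: "nat \<Rightarrow> real"
    assume y: "y 0 = 1" "\<And>u. 0 \<le> bilin \<alpha> (\<lambda>i j. \<Sum>k\<le>n. y k * a i j k) u u"
    \<comment> \<open>The coordinates of the point are the values of \<open>y\<close> at the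
      variables; \<open>y 0 = 1\<close> belongs to the constant.\<close>
    define x where "x = vec n (\<lambda>i. y (Suc i))"
    have eval: "eval_poly (lin n v) x = (\<Sum>k\<le>n. y k * v k)" for v
      unfolding eval_lin by (intro sum.cong) (auto simp: x_def y(1) split: nat.split)
    have "bilin \<alpha> (\<lambda>i j. map_mat (\<lambda>p. eval_poly p x) A $$ (i, j)) u u =
        bilin \<alpha> (\<lambda>i j. \<Sum>k\<le>n. y k * a i j k) u u" for u
      by (rule bilin_cong) (simp_all add: A eval)
    then have "x \<in> spectrahedron n \<alpha> A"
      using y(2) sym by (simp add: spectrahedron_def sym_psd_iff A) (simp add: x_def)
    then have "0 \<le> eval_poly (lin n ?f) x"
      using L unfolding f by blast
    then show "0 \<le> (\<Sum>k\<le>n. y k * ?f k)"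
      by (simp only: eval)
  qed (use sym supp in auto)
  then obtain l Q S c where "certificate n \<alpha> A f n l Q S c"
    using f A by auto
  \<comment> \<open>Shift from the indices 0 to n - 1 of \<open>certificate\<close> to 1 to
    n.\<close>
  moreover have "map (\<lambda>i. l (i - 1)) [1..<Suc k] = map l [0..<k]" for k
    unfolding One_nat_def map_Suc_upt[symmetric] by (simp add: comp_def)
  ultimately have "?R (\<lambda>i. l (i - 1)) (\<lambda>i. Q (i - 1)) S c"
    unfolding certificate_def
    by (auto simp del: upt_Suc simp: Suc_le_eq gr0_conv_Suc)
  then show "\<exists>l Q S c. ?R l Q S c"
    by (intro exI[of _ "\<lambda>i. l (i - 1)"] exI[of _ "\<lambda>i. Q (i - 1)"] exI[of _ S] exI[of _ c])
next
  assume "\<exists>l Q S c. ?R l Q S c"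
  then obtain l Q S c where R: "?R l Q S c" by blast
  have A: "A \<in> carrier_mat \<alpha> \<alpha>" using assms(1) by (simp add: linear_pencil_def)
  show ?L
  proof
    fix x assume x: "x \<in> spectrahedron n \<alpha> A"
    \<comment> \<open>Once the earlier \<open>l\<close> vanish at \<open>x\<close>, the square and
      the trace are nonnegative values with sum 0.\<close>
    have zero: "eval_poly (l i) x = 0" if "i \<in> {1..n}" for i
      using that
    proof (induction i rule: less_induct)
      case (less i)
      have "eval_poly ((l i)\<^sup>2 + mat_trace (A * Q i)) x = 0"
      proof (rule eval_ideal_gen)
        show "(l i)\<^sup>2 + mat_trace (A * Q i) \<in> ideal_gen n (map l [1..<i])"
          using R less.prems by blast
      qed (use less in auto)
      moreover obtain t P where "P \<in> carrier_mat t \<alpha>" "Q i = transpose_mat P * P"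
        using R less.prems unfolding quadratic_sos_matrix_def sos_matrix_def by blast
      then have "0 \<le> eval_poly (mat_trace (A * Q i)) x"
        using eval_mat_trace_gram_nonneg[OF x A] by (simp add: transpose_mult_eq_gram)
      ultimately have "(eval_poly (l i) x)\<^sup>2 \<le> 0"
        by (simp add: eval_poly_add eval_poly_mult power2_eq_square)
      then show ?case by simp
    qed
    have "eval_poly (f - const_poly c - mat_trace (A * map_mat const_poly S)) x = 0"
    proof (rule eval_ideal_gen)
      show "f - const_poly c - mat_trace (A * map_mat const_poly S) \<in> ideal_gen n (map l [1..<Suc n])"
        using R by blast
    qed (use zero in auto)
    moreover have "0 \<le> eval_poly (mat_trace (A * map_mat const_poly S)) x"
    proof -
      have S: "sym_psd \<alpha> S" using R by blast
      \<comment> \<open>A constant positive semidefinite \<open>S\<close> is also a Gram matrix, so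
        the same nonnegativity lemma applies.\<close>
      then obtain w where "\<forall>i<\<alpha>. \<forall>j<\<alpha>. S $$ (i, j) = (\<Sum>m<\<alpha>. w m i * w m j)"
        using psd_decomposition[of \<alpha> "\<lambda>i j. S $$ (i, j)"] unfolding sym_psd_iff by blast
      then have "map_mat const_poly S = gram \<alpha> \<alpha> (\<lambda>m i. const_poly (w m i))"
        using S by (intro eq_matI) (auto simp: gram_def sym_psd_iff const_poly_sum const_poly_hom)
      then show ?thesis
        using eval_mat_trace_gram_nonneg[OF x A] by simp
    qed
    ultimately show "0 \<le> eval_poly f x"
      using R by (simp add: eval_poly_diff)
  qed
qed

end
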